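(* Let $0<\alpha\le2$, $j\ne0$, $G,V\in C^2(\mathbb{T})$, and assume $G$ satisfies (M) and (W). Then there is a sequence of trigonometric polynomials $(G_n)_{n\in\mathbb{N}}$ such that each $G_n$ satisfies (M) and (W), and $\|G-G_n\|_{C^2(\mathbb{T})}\to0$. Furthermore, if $(m_n,\overline{H}_n)$ denotes the (unique) solution of problem (P) with kernel $G_n$, then there exists $(m,\overline{H})\in C^2(\mathbb{T})\times\mathbb{R}$ with $\|m-m_n\|_{C^2(\mathbb{T})}\to0$ and $\overline{H}_n\to\overline{H}$, and $(m,\overline{H})$ is the unique solution of problem (P) with kernel $G$.
   Context: $\mathbb{T}=\mathbb{R}/\mathbb{Z}$. Problem (P): given $0<\alpha\le2$, $j\ne0$, $V,G\in C^2(\mathbb{T})$, find $(m,\overline{H})\in C(\mathbb{T})\times\mathbb{R}$ with $m>0$ on $\mathbb{T}$, $\int_{\mathbb{T}}m=1$, and $\frac{j^2}{2m(x)^\alpha}+V(x)=\int_{\mathbb{T}}G(x-y)m(y)\,dy+\overline{H}$ for all $x\in\mathbb{T}$. Condition (M): $\int_{\mathbb{T}^2}G(x-y)f(x)f(y)\,dx\,dy\ge0$ for all $f\in C(\mathbb{T})$. Condition (W): $\int_{\mathbb{T}}G(y)\,dy>0$. *)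

theory Defs
  imports "HOL-Analysis.Analysis"
begin

text \<open>Functions on the torus T = R/Z are represented as 1-periodic functions R -> R.
  Integrals over T are integrals over the period [0,1].\<close>

definition periodic1 :: "(real \<Rightarrow> real) \<Rightarrow> bool" where
  "periodic1 f \<longleftrightarrow> (\<forall>x. f (x + 1) = f x)"

definition CT :: "(real \<Rightarrow> real) \<Rightarrow> bool" where
  "CT f \<longleftrightarrow> periodic1 f \<and> continuous_on UNIV f"

definition C2T :: "(real \<Rightarrow> real) \<Rightarrow> bool" where
  "C2T f \<longleftrightarrow> periodic1 f \<and>
     (\<exists>f' f''. (\<forall>x. (f has_real_derivative f' x) (at x)) \<and>
              (\<forall>x. (f' has_real_derivative f'' x) (at x)) \<and> continuous_on UNIV f'')"

definition c2_norm :: "(real \<Rightarrow> real) \<Rightarrow> real" where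
  "c2_norm f = (SUP x\<in>{0..1}. \<bar>f x\<bar>) + (SUP x\<in>{0..1}. \<bar>deriv f x\<bar>)
              + (SUP x\<in>{0..1}. \<bar>deriv (deriv f) x\<bar>)"

definition trig_poly :: "(real \<Rightarrow> real) \<Rightarrow> bool" where
  "trig_poly g \<longleftrightarrow> (\<exists>N::nat. \<exists>a b :: nat \<Rightarrow> real. \<forall>x.
     g x = (\<Sum>k\<le>N. a k * cos (2 * pi * real k * x) + b k * sin (2 * pi * real k * x)))"

definition conv_T :: "(real \<Rightarrow> real) \<Rightarrow> (real \<Rightarrow> real) \<Rightarrow> real \<Rightarrow> real" where
  "conv_T G m x = integral {0..1} (\<lambda>y. G (x - y) * m y)"

definition cond_M :: "(real \<Rightarrow> real) \<Rightarrow> bool" where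
  "cond_M G \<longleftrightarrow> (\<forall>f. CT f \<longrightarrow>
     integral {0..1} (\<lambda>x. integral {0..1} (\<lambda>y. G (x - y) * f x * f y)) \<ge> 0)"

definition cond_W :: "(real \<Rightarrow> real) \<Rightarrow> bool" where
  "cond_W G \<longleftrightarrow> integral {0..1} G > 0"

definition solves_P :: "real \<Rightarrow> real \<Rightarrow> (real \<Rightarrow> real) \<Rightarrow> (real \<Rightarrow> real)
    \<Rightarrow> (real \<Rightarrow> real) \<Rightarrow> real \<Rightarrow> bool" where
  "solves_P \<alpha> j V G m H \<longleftrightarrow> CT m \<and> (\<forall>x. m x > 0) \<and> integral {0..1} m = 1 \<and>
     (\<forall>x. j\<^sup>2 / (2 * m x powr \<alpha>) + V x = conv_T G m x + H)"

end

(* Testing the difference of two solutions with m1 - m2, (M) and the strict monotonicity of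
   j^2 / (2 m^alpha) give a stability estimate in the sup norm, in particular uniqueness. It needs two-sided
   bounds on m. Since m is a probability density, G * m - V has a Lipschitz derivative with a constant
   independent of m, so j^2 / (2 m^alpha) is at most quadratic near its minimum; if that minimum were too
   small, then the mass of m would exceed 1, as alpha <= 2. Existence follows by continuation along t G,
   0 <= t <= 1, each step being a contraction by the stability estimate. For G_n take the Fejer means of G:
   (M) makes the cosine coefficients of G nonnegative, and Fejer means keep this. Stability gives
   m_n -> m uniformly, and the equation upgrades this to C^2, as the derivatives fall on the kernel. *)
theory Submission
  imports Defs
begin

subsection \<open>Periodic functions and convolutions\<close>

text \<open>Everything quantitative hangs on one number: the Lipschitz constant \<open>K\<close> of
  the derivative of \<open>u = G * m - V + H\<close>, the value of the coupling term. Convolution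
  with a probability density does not increase such a constant, so \<open>K\<close> is known before
  \<open>m\<close> is. The same fact makes the bounds uniform along the continuation, and uniform in
  \<open>n\<close> for the Fejer means, because the Fejer kernel is itself a probability density.
  The obstacle in the stability estimate is that (M) controls the difference of two solutions only
  in an integral sense, while \<open>H1 - H2\<close> is a further unknown. The L2 bound yields an L1
  bound; averaging the equation then bounds \<open>H1 - H2\<close>; only after that does the
  equation, read pointwise, give the sup norm. In the continuation only the increment of the kernel
  is frozen at a given density. The contraction factor is the step length times a number independent
  of \<open>t\<close>, so finitely many equal steps reach \<open>t = 1\<close>. No compactness is
  used for the limit: \<open>m\<close> is the solution for \<open>G\<close> itself, and stability
  compares it with each \<open>m_n\<close>.\<close>

lemma continuous_integrable [intro]:
  fixes f :: "real \<Rightarrow> real"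
  shows "continuous_on UNIV f \<Longrightarrow> f integrable_on {a..b}"
  by (metis continuous_on_subset integrable_continuous_real subset_UNIV)

lemma has_derivative_continuous_on:
  fixes f :: "real \<Rightarrow> real"
  shows "(\<And>x. (f has_real_derivative f' x) (at x)) \<Longrightarrow> continuous_on UNIV f"
  by (rule DERIV_continuous_on)

lemma CT_D: "CT f \<Longrightarrow> periodic1 f" "CT f \<Longrightarrow> continuous_on UNIV f"
  by (auto simp: CT_def)

lemma periodic1_add_int:
  assumes "periodic1 f"
  shows "f (x + of_int k) = f x"
proof -
  have nat: "f (x + of_nat n) = f x" for n x
  proof (induction n)
    case (Suc n)
    have "f (x + of_nat (Suc n)) = f ((x + of_nat n) + 1)"
      by (simp add: add_ac)
    with Suc assms show ?case
      by (simp only: periodic1_def)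
  qed simp
  show ?thesis
  proof (cases "k \<ge> 0")
    case True
    then show ?thesis
      using nat[of x "nat k"] by simp
  next
    case False
    then show ?thesis
      using nat[of "x + of_int k" "nat (- k)"] by simp
  qed
qed

lemma periodic1_translate:
  assumes "periodic1 f"
  obtains y where "y \<in> {a..a + 1}" "f y = f x"
proof
  define k where "k = \<lfloor>x - a\<rfloor>"
  show "x - of_int k \<in> {a..a + 1}"
    unfolding k_def by (simp; linarith)
  show "f (x - of_int k) = f x"
    using periodic1_add_int[OF assms, of x "- k"] by simp
qed

lemma integral_period:
  assumes "CT f"
  shows "integral {a..a + 1} f = integral {0..1} f"
proof -
  note c = CT_D[OF assms]
  \<comment> \<open>The integer \<open>k\<close> cuts the window; moving the piece left of
    \<open>k\<close> by one period turns the window into \<open>{k..k + 1}\<close>, which is an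
    integer translate of \<open>{0..1}\<close>.\<close>
  define k where "k = \<lceil>a\<rceil>"
  have k: "a \<le> of_int k" "of_int k \<le> a + 1"
    unfolding k_def by linarith+
  have f1: "f \<circ> (+) (of_int j) = f" for j
    using periodic1_add_int[OF c(1)] by (auto simp: fun_eq_iff add.commute)
  have "integral {a..a + 1} f = integral {a..of_int k} f + integral {of_int k..a + 1} f"
    using k continuous_integrable[OF c(2)]
    by (simp add: Henstock_Kurzweil_Integration.integral_combine)
  also have "integral {a..of_int k} f = integral {a + 1..of_int k + 1} f"
    using integral_shift_Icc_real[of a "of_int k" f 1] f1[of 1] by simp
  also have "integral {a + 1..of_int k + 1} f + integral {of_int k..a + 1} f
      = integral {of_int k..of_int k + 1} f"
    using Henstock_Kurzweil_Integration.integral_combine[of "of_int k" "a + 1" "of_int k + 1" f] k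
      continuous_integrable[OF c(2), of "of_int k" "of_int k + 1"] by simp
  also have "\<dots> = integral {0..1} f"
    using integral_shift_Icc_real[of 0 1 f "of_int k"] f1[of k] by (simp add: add.commute)
  finally show ?thesis .
qed

lemma CT_bounded:
  assumes "CT f"
  obtains B where "B > 0" "\<And>x. \<bar>f x\<bar> \<le> B"
proof -
  have "compact (f ` {0..0 + 1})"
    using CT_D[OF assms] by (intro compact_continuous_image) (auto intro: continuous_on_subset)
  then have "bounded (f ` {0..0 + 1})"
    by (rule compact_imp_bounded)
  then obtain B where B: "B > 0" "\<forall>y\<in>f ` {0..0 + 1}. norm y \<le> B"
    unfolding bounded_pos by metis
  have "\<bar>f x\<bar> \<le> B" for x
  proof -
    obtain y where "y \<in> {0..0 + 1}" "f y = f x"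
      using periodic1_translate[OF CT_D(1)[OF assms]] by metis
    then show ?thesis
      using B(2) by (metis add_0 imageI real_norm_def)
  qed
  with B(1) that show ?thesis by blast
qed

lemma CT_attains_min:
  assumes "CT f"
  obtains x0 where "\<And>x. f x0 \<le> f x"
proof -
  have "continuous_on {0..1} f"
    using CT_D(2)[OF assms] by (rule continuous_on_subset) simp
  then obtain x0 where x0: "x0 \<in> {0..1}" "\<forall>y\<in>{0..1}. f x0 \<le> f y"
    using continuous_attains_inf[of "{0..1::real}" f] by auto
  have "f x0 \<le> f x" for x
  proof -
    obtain y where "y \<in> {0..0 + 1}" "f y = f x"
      using periodic1_translate[OF CT_D(1)[OF assms]] by metis
    then show ?thesis
      using x0 by (metis add_0)
  qed
  with that show ?thesis by blast
qed

lemma CT_uniform_continuity: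
  assumes "CT f" "e > 0"
  obtains d where "d > 0" "\<And>x y. \<bar>x - y\<bar> < d \<Longrightarrow> \<bar>f x - f y\<bar> < e"
proof -
  \<comment> \<open>An integer shift brings \<open>x\<close> into the unit interval, and a point
    \<open>y\<close> at distance below 1 then stays in \<open>{-1..2}\<close>.\<close>
  have "uniformly_continuous_on {-1..2} f"
    using CT_D[OF assms(1)] by (intro compact_uniformly_continuous) (auto intro: continuous_on_subset)
  then obtain d where d: "d > 0" "\<And>x y. x \<in> {-1..2} \<Longrightarrow> y \<in> {-1..2} \<Longrightarrow> dist x y < d \<Longrightarrow> dist (f x) (f y) < e"
    using assms(2) unfolding uniformly_continuous_on_def by metis
  show ?thesis
  proof
    show "min d 1 > 0" using d by simp
    fix x y :: real assume xy: "\<bar>x - y\<bar> < min d 1"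
    define k where "k = \<lfloor>x\<rfloor>"
    have "x + of_int (- k) \<in> {-1..2}" "y + of_int (- k) \<in> {-1..2}"
      using xy unfolding k_def by (simp_all; linarith)+
    then have "dist (f (x + of_int (- k))) (f (y + of_int (- k))) < e"
      using xy by (intro d(2)) (auto simp: dist_real_def)
    then show "\<bar>f x - f y\<bar> < e"
      by (simp only: periodic1_add_int[OF CT_D(1)[OF assms(1)]] dist_real_def)
  qed
qed

lemma abs_integral_le:
  fixes f :: "real \<Rightarrow> real"
  assumes "continuous_on UNIV f" "continuous_on UNIV g" "\<And>x. x \<in> {0..1} \<Longrightarrow> \<bar>f x\<bar> \<le> g x"
  shows "\<bar>integral {0..1} f\<bar> \<le> integral {0..1} g"
  using integral_norm_bound_integral[of f "{0..1}" g] assms by auto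

lemma integral_mono_unit:
  fixes f :: "real \<Rightarrow> real"
  assumes "continuous_on UNIV f" "continuous_on UNIV g" "\<And>x. x \<in> {0..1} \<Longrightarrow> f x \<le> g x"
  shows "integral {0..1} f \<le> integral {0..1} g"
  using assms by (intro integral_le) auto

section \<open>Convolution on the torus\<close>

lemma continuous_on_UNIV_compose:
  "continuous_on UNIV f \<Longrightarrow> continuous_on S g \<Longrightarrow> continuous_on S (\<lambda>x. f (g x))"
  for f :: "real \<Rightarrow> real"
  by (rule continuous_on_compose2) auto

lemma continuous_conv_integrand:
  fixes G m :: "real \<Rightarrow> real"
  assumes "continuous_on UNIV G" "continuous_on UNIV m"
  shows "continuous_on UNIV (\<lambda>y. G (x - y) * m y)"
  by (intro continuous_intros continuous_on_UNIV_compose[OF assms(1)] assms(2))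

lemma continuous_conv_T:
  assumes "continuous_on UNIV G" "continuous_on UNIV m"
  shows "continuous_on UNIV (conv_T G m)"
proof -
  have "continuous_on UNIV (\<lambda>x. integral (cbox 0 1) (\<lambda>y. G (x - y) * m y))"
    by (intro integral_continuous_on_param)
      (auto simp: split_beta intro!: continuous_intros continuous_on_UNIV_compose[OF assms(1)]
        continuous_on_UNIV_compose[OF assms(2)])
  then show ?thesis
    by (simp add: conv_T_def[abs_def])
qed

lemma periodic1_conv_T:
  assumes "periodic1 G"
  shows "periodic1 (conv_T G m)"
proof -
  have "G (x + 1 - y) = G (x - y)" for x y
    using periodic1_add_int[OF assms, of "x - y" 1] by (simp add: algebra_simps)
  then show ?thesis
    by (simp add: periodic1_def conv_T_def)
qed

lemma CT_conv_T: "CT G \<Longrightarrow> CT m \<Longrightarrow> CT (conv_T G m)"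
  using continuous_conv_T periodic1_conv_T by (simp add: CT_def)

text \<open>The substitution \<open>z = x - y\<close> moves the window to \<open>{x - 1..x}\<close>,
  and all windows of length one give a periodic integrand the same integral.\<close>

lemma conv_T_commute:
  assumes "CT f" "CT g"
  shows "conv_T f g x = conv_T g f x"
proof -
  define k where "k = (\<lambda>z. f z * g (x - z))"
  have "g (x - (z + 1)) = g (x - z)" for z
    using periodic1_add_int[OF CT_D(1)[OF assms(2)], of "x - z" "-1"] by (simp add: algebra_simps)
  then have ct: "CT k"
    using assms continuous_conv_integrand[of g f x]
    by (auto simp: CT_def periodic1_def k_def mult.commute)
  have "conv_T f g x = integral {-1..0} (\<lambda>y. f (x + y) * g (- y))"
    unfolding conv_T_def
    using Henstock_Kurzweil_Integration.integral_reflect_real[of 1 0 "\<lambda>y. f (x - y) * g y"] by simp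
  also have "\<dots> = integral {-1..0} (k \<circ> (+) x)"
    by (simp add: k_def o_def)
  also have "\<dots> = integral {x - 1..x - 1 + 1} k"
    by (subst integral_shift_Icc_real) (simp add: add.commute)
  also have "\<dots> = integral {0..1} k"
    by (rule integral_period[OF ct])
  finally show ?thesis
    by (simp add: conv_T_def k_def mult.commute)
qed

lemma conv_T_bound:
  assumes "continuous_on UNIV G" "continuous_on UNIV m" "\<And>x. \<bar>G x\<bar> \<le> B"
  shows "\<bar>conv_T G m x\<bar> \<le> B * integral {0..1} (\<lambda>y. \<bar>m y\<bar>)"
proof -
  have "\<bar>conv_T G m x\<bar> \<le> integral {0..1} (\<lambda>y. B * \<bar>m y\<bar>)"
    unfolding conv_T_def
    by (intro abs_integral_le continuous_conv_integrand assms(1,2) continuous_intros)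
      (auto simp: abs_mult intro!: mult_right_mono assms(3))
  then show ?thesis by simp
qed

lemma conv_T_diff_right:
  assumes "continuous_on UNIV G" "continuous_on UNIV m1" "continuous_on UNIV m2"
  shows "conv_T G (\<lambda>y. m1 y - m2 y) x = conv_T G m1 x - conv_T G m2 x"
  unfolding conv_T_def
  by (subst Henstock_Kurzweil_Integration.integral_diff[symmetric])
    (auto simp: left_diff_distrib right_diff_distrib intro!: continuous_conv_integrand assms)

lemma conv_T_diff_left:
  assumes "continuous_on UNIV G1" "continuous_on UNIV G2" "continuous_on UNIV m"
  shows "conv_T (\<lambda>y. G1 y - G2 y) m x = conv_T G1 m x - conv_T G2 m x"
  unfolding conv_T_def
  by (subst Henstock_Kurzweil_Integration.integral_diff[symmetric])
    (auto simp: left_diff_distrib right_diff_distrib intro!: continuous_conv_integrand assms)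

lemma conv_T_scale_left: "conv_T (\<lambda>y. t * G y) m x = t * conv_T G m x"
  by (simp add: conv_T_def mult.assoc)

text \<open>Differentiation under the integral sign puts the derivative on \<open>G\<close> alone.
  This is how a continuous solution \<open>m\<close> acquires the smoothness of the data.\<close>

lemma has_derivative_conv_T:
  assumes "\<And>x. (G has_real_derivative G' x) (at x)" "continuous_on UNIV G'" "continuous_on UNIV m"
  shows "(conv_T G m has_real_derivative conv_T G' m x) (at x)"
proof -
  have contG: "continuous_on UNIV G"
    using assms(1) by (rule has_derivative_continuous_on)
  have "((\<lambda>x. integral (cbox 0 1) (\<lambda>y. G (x - y) * m y)) has_field_derivative
      integral (cbox 0 1) (\<lambda>y. G' (x - y) * m y)) (at x within UNIV)"
  proof (rule leibniz_rule_field_derivative)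
    show "((\<lambda>x. G (x - t) * m t) has_real_derivative G' (x - t) * m t) (at x within UNIV)" for x t
      by (auto intro!: derivative_eq_intros DERIV_chain2[OF assms(1)])
    show "(\<lambda>y. G (x - y) * m y) integrable_on cbox 0 1" for x
      using continuous_conv_integrand[OF contG assms(3)] by auto
    show "continuous_on (UNIV \<times> cbox 0 1) (\<lambda>(x, t). G' (x - t) * m t)"
      by (auto simp: split_beta intro!: continuous_intros continuous_on_UNIV_compose[OF assms(2)]
          continuous_on_UNIV_compose[OF assms(3)])
  qed auto
  then show ?thesis
    by (simp add: conv_T_def[abs_def])
qed

lemma cond_M_iff:
  "cond_M G \<longleftrightarrow> (\<forall>f. CT f \<longrightarrow> 0 \<le> integral {0..1} (\<lambda>x. f x * conv_T G f x))"
proof -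
  have "integral {0..1} (\<lambda>y. G (x - y) * f x * f y) = f x * conv_T G f x" for f x
  proof -
    have "(\<lambda>y. G (x - y) * f x * f y) = (\<lambda>y. f x * (G (x - y) * f y))"
      by (auto simp: mult_ac)
    then show ?thesis
      by (simp add: conv_T_def)
  qed
  then show ?thesis
    by (simp add: cond_M_def)
qed

lemma cond_M_scale:
  assumes "cond_M G" "t \<ge> 0"
  shows "cond_M (\<lambda>x. t * G x)"
  using assms unfolding cond_M_def by (simp add: mult.assoc)

text \<open>Zeros are allowed, unlike for solutions: the set must be closed under uniform limits for
  the fixed point argument, and it must contain the Fejer kernels.\<close>

definition density_T :: "(real \<Rightarrow> real) \<Rightarrow> bool" where
  "density_T m \<longleftrightarrow> CT m \<and> (\<forall>x. 0 \<le> m x) \<and> integral {0..1} m = 1"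

lemma conv_T_density_bound:
  assumes "density_T m" "continuous_on UNIV G" "\<And>x. \<bar>G x\<bar> \<le> B"
  shows "\<bar>conv_T G m x\<bar> \<le> B"
  using conv_T_bound[OF assms(2) _ assms(3), of m x] assms(1) by (auto simp: density_T_def CT_def)

text \<open>The constant is carried explicitly because the bounds on solutions depend on the data
  only through it.\<close>

definition C11 :: "real \<Rightarrow> (real \<Rightarrow> real) \<Rightarrow> bool" where
  "C11 K w \<longleftrightarrow> periodic1 w \<and> (\<exists>w'. (\<forall>x. (w has_real_derivative w' x) (at x)) \<and>
     (\<forall>x y. \<bar>w' x - w' y\<bar> \<le> K * \<bar>x - y\<bar>))"

lemma C11_CT: "C11 K w \<Longrightarrow> CT w"
  unfolding C11_def CT_def using has_derivative_continuous_on by blast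

lemma C11_mono: "C11 K w \<Longrightarrow> K \<le> K' \<Longrightarrow> C11 K' w"
  unfolding C11_def by (meson abs_ge_zero mult_right_mono order_trans)

lemma C11_add_const:
  assumes "C11 K w"
  shows "C11 K (\<lambda>x. w x + H)"
proof -
  obtain w' where "\<And>x. (w has_real_derivative w' x) (at x)"
    "\<And>x y. \<bar>w' x - w' y\<bar> \<le> K * \<bar>x - y\<bar>"
    using assms unfolding C11_def by blast
  then show ?thesis
    using assms unfolding C11_def periodic1_def
    by (intro conjI exI[of _ w']) (auto intro!: derivative_eq_intros)
qed

lemma C11_add_scaled:
  assumes "C11 K1 u" "C11 K2 v"
  shows "C11 (K1 + \<bar>t\<bar> * K2) (\<lambda>x. u x + t * v x)"
proof -
  obtain u' v' where u': "\<And>x. (u has_real_derivative u' x) (at x)"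
      "\<And>x y. \<bar>u' x - u' y\<bar> \<le> K1 * \<bar>x - y\<bar>"
    and v': "\<And>x. (v has_real_derivative v' x) (at x)"
      "\<And>x y. \<bar>v' x - v' y\<bar> \<le> K2 * \<bar>x - y\<bar>"
    using assms unfolding C11_def by blast
  have "\<bar>(u' x + t * v' x) - (u' y + t * v' y)\<bar> \<le> (K1 + \<bar>t\<bar> * K2) * \<bar>x - y\<bar>" for x y
  proof -
    have "\<bar>(u' x + t * v' x) - (u' y + t * v' y)\<bar> = \<bar>(u' x - u' y) + t * (v' x - v' y)\<bar>"
      by (simp add: algebra_simps)
    also have "\<dots> \<le> \<bar>u' x - u' y\<bar> + \<bar>t\<bar> * \<bar>v' x - v' y\<bar>"
      by (metis abs_triangle_ineq abs_mult)
    also have "\<dots> \<le> K1 * \<bar>x - y\<bar> + \<bar>t\<bar> * (K2 * \<bar>x - y\<bar>)"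
      by (intro add_mono mult_left_mono u' v') auto
    finally show ?thesis by (simp add: algebra_simps)
  qed
  then show ?thesis
    using assms u'(1) v'(1) unfolding C11_def periodic1_def
    by (intro conjI exI[of _ "\<lambda>x. u' x + t * v' x"]) (auto intro!: derivative_eq_intros)
qed

text \<open>Averaging against a probability density preserves a Lipschitz bound, so \<open>K\<close>
  is independent of \<open>m\<close>. With \<open>m\<close> a solution this feeds the a priori
  bounds; with \<open>m\<close> a Fejer kernel it passes \<open>K\<close> from a kernel to its
  approximations.\<close>

lemma C11_conv_T:
  assumes "C11 K G" "density_T m"
  shows "C11 K (conv_T G m)"
proof -
  obtain G' where G': "\<And>x. (G has_real_derivative G' x) (at x)"
      "\<And>x y. \<bar>G' x - G' y\<bar> \<le> K * \<bar>x - y\<bar>"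
    using assms unfolding C11_def by blast
  have m: "continuous_on UNIV m"
    using assms(2) by (simp add: density_T_def CT_def)
  have "K \<ge> 0"
    using G'(2)[of 1 0] by simp
  then have "K-lipschitz_on UNIV G'"
    using G'(2) by (auto simp: lipschitz_on_def dist_real_def)
  then have cont: "continuous_on UNIV G'"
    by (rule lipschitz_on_continuous_on)
  have "\<bar>conv_T G' m x - conv_T G' m y\<bar> \<le> K * \<bar>x - y\<bar>" for x y
  proof -
    have c2: "continuous_on UNIV (\<lambda>z. G' (x - y + z))"
      by (intro continuous_on_UNIV_compose[OF cont] continuous_intros)
    \<comment> \<open>The translation by \<open>x - y\<close> is moved into the kernel, so that the
      difference becomes one convolution at \<open>y\<close> with a kernel bounded by
      \<open>K * \<bar>x - y\<bar>\<close>.\<close>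
    have "conv_T G' m x = conv_T (\<lambda>z. G' (x - y + z)) m y"
      by (simp add: conv_T_def)
    then have "conv_T G' m x - conv_T G' m y = conv_T (\<lambda>z. G' (x - y + z) - G' z) m y"
      by (simp add: conv_T_diff_left[OF c2 cont m])
    also have "\<bar>\<dots>\<bar> \<le> K * \<bar>x - y\<bar>"
      using G'(2)[of "x - y + z" z for z]
      by (intro conv_T_density_bound assms continuous_intros c2 cont) simp
    finally show ?thesis .
  qed
  moreover have "periodic1 (conv_T G m)"
    using assms by (auto simp: C11_def intro: periodic1_conv_T)
  ultimately show ?thesis
    using has_derivative_conv_T[OF G'(1) cont m] unfolding C11_def by blast
qed

lemma periodic1_derivative:
  assumes "periodic1 f" "\<And>x. (f has_real_derivative f' x) (at x)"
  shows "periodic1 f'"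
  unfolding periodic1_def
proof
  fix x
  have "((\<lambda>x. f (x + 1)) has_real_derivative f' (x + 1)) (at x)"
    using assms(2) by (simp add: DERIV_shift[symmetric])
  moreover have "(\<lambda>x. f (x + 1)) = f"
    using assms(1) by (auto simp: periodic1_def)
  ultimately show "f' (x + 1) = f' x"
    using assms(2) DERIV_unique by metis
qed

lemma C2T_obtain:
  assumes "C2T f"
  obtains f' f'' where "\<And>x. (f has_real_derivative f' x) (at x)"
    "\<And>x. (f' has_real_derivative f'' x) (at x)" "CT f" "CT f'" "CT f''"
proof -
  obtain f' f'' where f: "\<And>x. (f has_real_derivative f' x) (at x)"
    "\<And>x. (f' has_real_derivative f'' x) (at x)" "continuous_on UNIV f''"
    using assms unfolding C2T_def by blast
  have per: "periodic1 f" "periodic1 f'" "periodic1 f''"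
    using assms periodic1_derivative f unfolding C2T_def by blast+
  have "continuous_on UNIV f" "continuous_on UNIV f'"
    using f has_derivative_continuous_on by blast+
  with per f that show ?thesis
    by (auto simp: CT_def)
qed

lemma C11I:
  assumes "periodic1 f" "\<And>x. (f has_real_derivative f' x) (at x)"
    "\<And>x. (f' has_real_derivative f'' x) (at x)" "\<And>x. \<bar>f'' x\<bar> \<le> K"
  shows "C11 K f"
proof -
  have "\<bar>f' x - f' y\<bar> \<le> K * \<bar>x - y\<bar>" for x y
    using field_differentiable_bound[of UNIV f' f'' K x y] assms by simp
  with assms(1,2) show ?thesis
    unfolding C11_def by blast
qed

subsection \<open>A priori bounds\<close>

text \<open>The derivative vanishes at the minimum, hence is at most
  \<open>K * \<bar>x - x0\<bar>\<close> on the segment. The mean value inequality loses the factor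
  1/2 of Taylor's formula, which is harmless here.\<close>

lemma C11_quadratic_bound:
  assumes "C11 K u" "\<And>x. u x0 \<le> u x"
  shows "u x \<le> u x0 + K * (x - x0)\<^sup>2"
proof -
  obtain u' where u': "\<And>x. (u has_real_derivative u' x) (at x)"
      "\<And>x y. \<bar>u' x - u' y\<bar> \<le> K * \<bar>x - y\<bar>"
    using assms(1) unfolding C11_def by blast
  have K: "K \<ge> 0"
    using u'(2)[of 1 0] by simp
  have "u' x0 = 0"
    by (rule DERIV_local_min[OF u'(1), of 1]) (auto simp: assms(2))
  then have "\<bar>u' z\<bar> \<le> K * \<bar>x - x0\<bar>" if "z \<in> closed_segment x x0" for z
  proof -
    have "\<bar>z - x0\<bar> \<le> \<bar>x - x0\<bar>"
      using that by (auto simp: closed_segment_eq_real_ivl split: if_splits)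
    then have "K * \<bar>z - x0\<bar> \<le> K * \<bar>x - x0\<bar>"
      using K by (rule mult_left_mono)
    with u'(2)[of z x0] \<open>u' x0 = 0\<close> show ?thesis by simp
  qed
  then have "norm (u x - u x0) \<le> (K * \<bar>x - x0\<bar>) * norm (x - x0)"
    using u'(1) by (intro field_differentiable_bound[of "closed_segment x x0" u u'])
      (auto intro: has_field_derivative_at_within)
  moreover have "K * \<bar>x - x0\<bar> * \<bar>x - x0\<bar> = K * (x - x0)\<^sup>2"
    by (simp add: power2_eq_square mult.assoc)
  ultimately show ?thesis
    unfolding real_norm_def by linarith
qed

lemma integral_inverse_affine:
  fixes a b s :: real
  assumes "a > 0" "b > 0" "s \<ge> 0"
  shows "integral {x0..x0 + s} (\<lambda>x. 1 / (a + b * (x - x0))) = ln (1 + b * s / a) / b"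
proof -
  have "((\<lambda>x. 1 / (a + b * (x - x0))) has_integral
      ln (a + b * (x0 + s - x0)) / b - ln (a + b * (x0 - x0)) / b) {x0..x0 + s}"
  proof (intro fundamental_theorem_of_calculus)
    fix x assume "x \<in> {x0..x0 + s}"
    then have "a + b * (x - x0) > 0"
      using assms by (intro add_pos_nonneg mult_nonneg_nonneg) auto
    then have "((\<lambda>x. ln (a + b * (x - x0)) / b) has_real_derivative 1 / (a + b * (x - x0)))
        (at x within {x0..x0 + s})"
      using assms by (auto intro!: derivative_eq_intros)
    then show "((\<lambda>x. ln (a + b * (x - x0)) / b) has_vector_derivative 1 / (a + b * (x - x0)))
        (at x within {x0..x0 + s})"
      by (rule has_real_derivative_iff_has_vector_derivative[THEN iffD1])
  qed (use assms in auto)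
  moreover have "ln (a + b * s) - ln a = ln (1 + b * s / a)"
  proof -
    have "0 < a + b * s"
      using assms by (intro add_pos_nonneg) auto
    then have "ln (a + b * s) - ln a = ln ((a + b * s) / a)"
      using assms by (simp add: ln_div)
    also have "(a + b * s) / a = 1 + b * s / a"
      using assms by (simp add: field_simps)
    finally show ?thesis .
  qed
  ultimately show ?thesis
    by (simp add: integral_unique diff_divide_distrib[symmetric])
qed

text \<open>The constant \<open>c\<close> stands for \<open>j\<^sup>2 / 2\<close>; only its
  positivity matters.\<close>

locale power_coupling =
  fixes \<alpha> c :: real
  assumes \<alpha>: "0 < \<alpha>" "\<alpha> \<le> 2" and c: "0 < c"
begin

text \<open>This is the inverse of \<open>m \<mapsto> c / m powr \<alpha>\<close> on the positive
  reals; the equation becomes \<open>m x = dens (u x)\<close> with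
  \<open>u = G * m - V + H\<close>.\<close>

definition dens :: "real \<Rightarrow> real" where
  "dens t = (c / t) powr (1 / \<alpha>)"

lemma dens_pos: "t > 0 \<Longrightarrow> dens t > 0"
  using c by (simp add: dens_def)

lemma dens_antimono: "0 < s \<Longrightarrow> s \<le> t \<Longrightarrow> dens t \<le> dens s"
  unfolding dens_def using c \<alpha> by (intro powr_mono2) (auto simp: divide_left_mono)

lemma dens_c [simp]: "dens c = 1"
  using c by (simp add: dens_def)

lemma dens_eq_iff:
  assumes "t > 0" "m > 0"
  shows "dens t = m \<longleftrightarrow> c / m powr \<alpha> = t"
proof
  assume "dens t = m"
  then have "m powr \<alpha> = c / t"
    using \<alpha> c assms by (auto simp: dens_def powr_powr)
  then show "c / m powr \<alpha> = t"
    using c assms by (simp add: field_simps)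
next
  assume "c / m powr \<alpha> = t"
  then have "c / t = m powr \<alpha>"
    using c assms by auto
  then show "dens t = m"
    using \<alpha> assms by (simp add: dens_def powr_powr)
qed

lemma continuous_dens:
  assumes "continuous_on S u" "\<And>x. x \<in> S \<Longrightarrow> u x > 0"
  shows "continuous_on S (\<lambda>x. dens (u x))"
  unfolding dens_def using c \<alpha>
  by (intro continuous_intros assms) (use assms(2) c in \<open>auto simp: less_le\<close>)

lemma CT_dens:
  assumes "CT u" "\<And>x. u x > 0"
  shows "CT (\<lambda>x. dens (u x))"
  using assms continuous_dens[of UNIV u] by (auto simp: CT_def periodic1_def)

text \<open>Only here is the restriction on the exponent needed: near its minimum \<open>u\<close> is at most quadratic,
  so for \<open>\<alpha> \<le> 2\<close> the integrand is at least of order \<open>1 / (\<surd>\<delta> + x)\<close> there, and its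
  integral grows like \<open>ln (1 / \<delta>)\<close>.\<close>

lemma integral_dens_large:
  assumes "K > 0"
  obtains \<delta> where "0 < \<delta>" "\<delta> \<le> c"
    "\<And>u x0. C11 K u \<Longrightarrow> (\<And>x. 0 < u x) \<Longrightarrow> (\<And>x. u x0 \<le> u x) \<Longrightarrow> u x0 \<le> \<delta> \<Longrightarrow>
      integral {0..1} (\<lambda>x. dens (u x)) > 1"
proof -
  \<comment> \<open>\<open>c \<le> L\<close> makes \<open>s \<le> 1\<close>, so the interval of
    length \<open>s\<close> fits into a period. \<open>L * s\<^sup>2 = c / 2\<close> and
    \<open>\<delta> \<le> c / 2\<close> keep \<open>u \<le> c\<close> on it. The logarithmic
    integral there has argument \<open>1 + q\<close>, and \<open>q\<close> is chosen such that it
    exceeds 2.\<close>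
  define L where "L = max K c"
  define s where "s = sqrt (c / (2 * L))"
  define q where "q = exp (2 * sqrt (L / c))"
  define \<delta> where "\<delta> = (sqrt L * s / q)\<^sup>2"
  have L: "L > 0" "K \<le> L" "c \<le> L"
    using c by (auto simp: L_def)
  have s: "0 < s" "s \<le> 1" "L * s\<^sup>2 = c / 2"
    using L c by (auto simp: s_def field_simps)
  have q: "q \<ge> 1"
    using L c by (simp add: q_def)
  have "\<delta> = L * s\<^sup>2 / q\<^sup>2"
    using L by (simp add: \<delta>_def power_mult_distrib power_divide)
  also have "\<dots> \<le> L * s\<^sup>2 / 1"
    using q L by (intro divide_left_mono) auto
  finally have \<delta>c: "\<delta> \<le> c / 2"
    using s by simp
  have \<delta>0: "\<delta> > 0"
    using L s q by (simp add: \<delta>_def)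
  show ?thesis
  proof
    show "0 < \<delta>" "\<delta> \<le> c"
      using \<delta>0 \<delta>c c by auto
    fix u x0
    assume u: "C11 K u" "\<And>x. 0 < u x" "\<And>x. u x0 \<le> u x" "u x0 \<le> \<delta>"
    define a where "a = sqrt \<delta>"
    define b where "b = sqrt L"
    have ab: "a > 0" "b > 0"
      using \<delta>0 L by (auto simp: a_def b_def)
    have ct: "CT (\<lambda>x. dens (u x))"
      using C11_CT[OF u(1)] u(2) by (rule CT_dens)
    note cont = CT_D(2)[OF ct]
    have "sqrt c / (a + b * (x - x0)) \<le> dens (u x)" if "x \<in> {x0..x0 + s}" for x
    proof -
      have "u x \<le> \<delta> + L * (x - x0)\<^sup>2"
        using C11_quadratic_bound[OF C11_mono[OF u(1) L(2)] u(3), of x] u(4) by simp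
      \<comment> \<open>The square adds only the nonnegative cross term; it turns the quadratic
        bound into an affine one after taking roots, so that the comparison integral is a
        logarithm.\<close>
      also have "\<dots> \<le> (a + b * (x - x0))\<^sup>2"
        using ab that \<delta>0 L by (simp add: power2_sum power_mult_distrib a_def b_def)
      finally have le: "u x \<le> (a + b * (x - x0))\<^sup>2" .
      have p: "0 < a + b * (x - x0)"
        using ab that by (intro add_pos_nonneg) auto
      have "L * (x - x0)\<^sup>2 \<le> L * s\<^sup>2"
        using L that by (intro mult_left_mono power_mono) auto
      with s \<delta>c \<open>u x \<le> \<delta> + L * (x - x0)\<^sup>2\<close> have "u x \<le> c"
        by simp
      then have ge1: "1 \<le> c / u x"
        using u(2)[of x] by simp
      have "sqrt c / (a + b * (x - x0)) = sqrt (c / (a + b * (x - x0))\<^sup>2)"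
        using p by (simp add: real_sqrt_divide)
      also have "\<dots> \<le> sqrt (c / u x)"
        using c p u(2)[of x] le by (intro real_sqrt_le_mono divide_left_mono) auto
      also have "\<dots> = (c / u x) powr (1 / 2)"
        using c u(2)[of x] by (simp add: powr_half_sqrt)
      \<comment> \<open>The base is at least 1 because \<open>u x \<le> c\<close>, and
        \<open>1 / 2 \<le> 1 / \<alpha>\<close>.\<close>
      also have "\<dots> \<le> dens (u x)"
        unfolding dens_def using ge1 \<alpha> by (intro powr_mono) (auto simp: field_simps)
      finally show ?thesis .
    qed
    then have "integral {x0..x0 + s} (\<lambda>x. sqrt c * (1 / (a + b * (x - x0))))
        \<le> integral {x0..x0 + s} (\<lambda>x. dens (u x))"
      using ab continuous_integrable[OF cont]
      by (intro integral_le integrable_continuous_real continuous_intros)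
        (auto simp: add_pos_nonneg less_imp_neq[symmetric] intro: continuous_on_subset[OF cont])
    moreover have "integral {x0..x0 + s} (\<lambda>x. sqrt c * (1 / (a + b * (x - x0))))
        = sqrt c * (ln (1 + b * s / a) / b)"
      using integral_inverse_affine[OF ab, of s x0] s
      by (simp only: Henstock_Kurzweil_Integration.integral_mult_right less_imp_le)
    moreover have "sqrt c * (ln (1 + b * s / a) / b) > 1"
    proof -
      have "b * s / a = q"
        using L s q by (simp add: a_def b_def \<delta>_def)
      then have "ln (1 + b * s / a) > ln q"
        using q by simp
      also have "ln q = 2 * sqrt (L / c)"
        by (simp add: q_def)
      finally have "sqrt c * (ln (1 + b * s / a) / b) > sqrt c * (2 * sqrt (L / c) / b)"
        using c ab by (intro mult_strict_left_mono divide_strict_right_mono) auto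
      also have "sqrt c * (2 * sqrt (L / c) / b) = 2"
        using c L by (simp add: b_def real_sqrt_divide)
      finally show ?thesis by simp
    qed
    moreover have "integral {x0..x0 + s} (\<lambda>x. dens (u x)) \<le> integral {x0..x0 + 1} (\<lambda>x. dens (u x))"
      using s(1,2) u(2) continuous_integrable[OF cont]
      by (intro integral_subset_le) (auto intro: less_imp_le dens_pos)
    moreover have "\<dots> = integral {0..1} (\<lambda>x. dens (u x))"
      by (rule integral_period[OF ct])
    ultimately show "integral {0..1} (\<lambda>x. dens (u x)) > 1"
      by simp
  qed
qed

text \<open>A minimum of \<open>u\<close> at or below \<open>\<delta>\<close> would give mass above
  1. A minimum above \<open>c\<close> would give \<open>m < 1\<close> everywhere, as
  \<open>dens c = 1\<close>, hence mass below 1. From a minimum at most \<open>c\<close>, the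
  quadratic bound over one period climbs by at most \<open>K\<close>, so \<open>M = c + K\<close>.
  Both bounds depend only on \<open>\<alpha>\<close>, \<open>c\<close> and \<open>K\<close>.\<close>

lemma a_priori_bounds:
  assumes "K > 0"
  obtains \<delta> M where "0 < \<delta>" "\<delta> \<le> M"
    "\<And>u m. C11 K u \<Longrightarrow> CT m \<Longrightarrow> (\<And>x. 0 < m x) \<Longrightarrow> integral {0..1} m = 1 \<Longrightarrow>
      (\<And>x. c / m x powr \<alpha> = u x) \<Longrightarrow> \<forall>x. u x \<in> {\<delta>..M} \<and> m x \<in> {dens M..dens \<delta>}"
proof -
  obtain \<delta> where \<delta>: "0 < \<delta>" "\<delta> \<le> c"
    "\<And>u x0. C11 K u \<Longrightarrow> (\<And>x. 0 < u x) \<Longrightarrow> (\<And>x. u x0 \<le> u x) \<Longrightarrow> u x0 \<le> \<delta> \<Longrightarrow>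
      integral {0..1} (\<lambda>x. dens (u x)) > 1"
    using integral_dens_large[OF assms] by metis
  show ?thesis
  proof
    show "0 < \<delta>" "\<delta> \<le> c + K"
      using \<delta> assms by auto
    fix u m
    assume *: "C11 K u" "CT m" "\<And>x. 0 < m x" "integral {0..1} m = 1" "\<And>x. c / m x powr \<alpha> = u x"
    have upos: "0 < u x" for x
      using *(3,5) c by (metis divide_pos_pos powr_gt_zero order_less_irrefl)
    have m: "m x = dens (u x)" for x
      using *(3,5) upos dens_eq_iff by metis
    obtain x0 where x0: "\<And>x. u x0 \<le> u x"
      using CT_attains_min[OF C11_CT[OF *(1)]] by metis
    have "integral {0..1} (\<lambda>x. dens (u x)) = 1"
      using *(4) m by (metis (no_types, lifting) ext)
    then have lower: "\<delta> < u x0"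
      using \<delta>(3)[OF *(1) upos x0] by fastforce
    have upper0: "u x0 \<le> c"
    proof (rule ccontr)
      assume n: "\<not> u x0 \<le> c"
      then have "c < u x" for x
        using x0[of x] by linarith
      then have "m x \<le> dens (u x0)" for x
        using dens_antimono[OF upos x0] m by simp
      then have "integral {0..1} m \<le> integral {0..1} (\<lambda>x::real. dens (u x0))"
        using CT_D[OF *(2)] by (intro integral_mono_unit) auto
      moreover have "dens (u x0) < 1"
        using n c \<alpha> powr_less_mono2[of "1 / \<alpha>" "c / u x0" 1] by (simp add: dens_def)
      ultimately show False
        using *(4) by simp
    qed
    have "u x \<le> c + K" for x
    proof -
      obtain y where y: "y \<in> {x0..x0 + 1}" "u y = u x"
        using periodic1_translate[of u] *(1) unfolding C11_def by metis
      have "K * (y - x0)\<^sup>2 \<le> K * 1"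
        using y assms by (intro mult_left_mono) (auto simp: abs_square_le_1)
      then show ?thesis
        using C11_quadratic_bound[OF *(1) x0, of y] upper0 y by simp
    qed
    moreover have "\<delta> \<le> u x" for x
      using lower x0[of x] by linarith
    ultimately show "\<forall>x. u x \<in> {\<delta>..c + K} \<and> m x \<in> {dens (c + K)..dens \<delta>}"
      using upos \<delta>(1) m by (simp add: dens_antimono)
  qed
qed

end

subsection \<open>Stability\<close>

lemma integral_add_unit:
  fixes f g :: "real \<Rightarrow> real"
  assumes "continuous_on UNIV f" "continuous_on UNIV g"
  shows "integral {0..1} (\<lambda>x. f x + g x) = integral {0..1} f + integral {0..1} g"
  using assms by (intro Henstock_Kurzweil_Integration.integral_add continuous_integrable)

lemma integral_diff_unit:
  fixes f g :: "real \<Rightarrow> real"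
  assumes "continuous_on UNIV f" "continuous_on UNIV g"
  shows "integral {0..1} (\<lambda>x. f x - g x) = integral {0..1} f - integral {0..1} g"
  using assms by (intro Henstock_Kurzweil_Integration.integral_diff continuous_integrable)

context power_coupling
begin

definition sol :: "(real \<Rightarrow> real) \<Rightarrow> (real \<Rightarrow> real) \<Rightarrow> (real \<Rightarrow> real) \<Rightarrow> real \<Rightarrow> bool" where
  "sol G V m H \<longleftrightarrow> CT m \<and> (\<forall>x. m x > 0) \<and> integral {0..1} m = 1 \<and>
     (\<forall>x. c / m x powr \<alpha> + V x = conv_T G m x + H)"

lemma sol_density: "sol G V m H \<Longrightarrow> density_T m"
  by (auto simp: sol_def density_T_def less_imp_le)

text \<open>By the mean value theorem \<open>r\<close> is minus the derivative of the coupling at an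
  intermediate point, and this quantity decreases in its argument, so its values at
  \<open>hi\<close> and \<open>lo\<close> serve as \<open>l\<close> and \<open>L\<close>. The bound
  from below gives strict monotonicity, the one from above is needed to estimate
  \<open>H1 - H2\<close>.\<close>

lemma coupling_slope:
  assumes "0 < lo" "lo \<le> hi"
  obtains l L where "l > 0" "L > 0"
    "\<And>a b. a \<in> {lo..hi} \<Longrightarrow> b \<in> {lo..hi} \<Longrightarrow>
      \<exists>r. l \<le> r \<and> r \<le> L \<and> c / a powr \<alpha> - c / b powr \<alpha> = - r * (a - b)"
proof
  define f where "f t = \<alpha> * c * t powr (- \<alpha> - 1)" for t
  have fmono: "f t \<le> f s" if "0 < s" "s \<le> t" for s t
    unfolding f_def using that \<alpha> c by (intro mult_left_mono powr_mono2') auto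
  show "f hi > 0" "f lo > 0"
    using assms \<alpha> c by (auto simp: f_def)
  have der: "((\<lambda>t. c / t powr \<alpha>) has_real_derivative - f t) (at t)" if "t > 0" for t
  proof -
    have "((\<lambda>t. c * t powr (- \<alpha>)) has_real_derivative c * (- \<alpha> * t powr (- \<alpha> - 1))) (at t)"
      using that by (intro DERIV_cmult) (auto intro!: derivative_eq_intros)
    then show ?thesis
      by (simp add: f_def powr_minus_divide mult_ac)
  qed
  have main: "\<exists>r. f hi \<le> r \<and> r \<le> f lo \<and> c / b powr \<alpha> - c / a powr \<alpha> = - r * (b - a)"
    if ab: "a \<in> {lo..hi}" "b \<in> {lo..hi}" "a < b" for a b
  proof -
    have pos: "0 < t" if "a \<le> t" for t
      using that ab assms by simp
    obtain z where z: "a < z" "z < b" "c / b powr \<alpha> - c / a powr \<alpha> = (b - a) * - f z"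
      using MVT2[of a b "\<lambda>t. c / t powr \<alpha>" "\<lambda>t. - f t"] ab(3) der[OF pos] by auto
    then show ?thesis
      using fmono[of lo z] fmono[of z hi] ab assms by (intro exI[of _ "f z"]) auto
  qed
  fix a b assume ab: "a \<in> {lo..hi}" "b \<in> {lo..hi}"
  consider "a < b" | "a = b" | "b < a" by linarith
  then show "\<exists>r. f hi \<le> r \<and> r \<le> f lo \<and> c / a powr \<alpha> - c / b powr \<alpha> = - r * (a - b)"
  proof cases
    case 1
    then obtain r where "f hi \<le> r" "r \<le> f lo" "c / b powr \<alpha> - c / a powr \<alpha> = - r * (b - a)"
      using main[OF ab] by blast
    then show ?thesis
      by (intro exI[of _ r]) (simp add: algebra_simps)
  next
    case 2
    then show ?thesis
      using fmono[of lo hi] assms by auto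
  next
    case 3
    then show ?thesis
      using main[OF ab(2) ab(1)] by blast
  qed
qed

text \<open>Testing the difference of the two equations with \<open>f = m1 - m2\<close>: the multipliers
  \<open>H1 - H2\<close> drop out as \<open>f\<close> has mean zero, the convolution term is nonnegative by \<open>cond_M\<close>,
  and strict monotonicity of the coupling controls \<open>f\<close> in \<open>L\<^sup>2\<close>.\<close>

lemma sol_stability:
  assumes "0 < lo" "lo \<le> hi" "0 \<le> B"
  obtains C where "C > 0"
    "\<And>G1 G2 V1 V2 m1 m2 H1 H2 D. sol G1 V1 m1 H1 \<Longrightarrow> sol G2 V2 m2 H2 \<Longrightarrow>
       CT G1 \<Longrightarrow> CT G2 \<Longrightarrow> CT V1 \<Longrightarrow> CT V2 \<Longrightarrow> cond_M G1 \<Longrightarrow> (\<And>x. \<bar>G1 x\<bar> \<le> B) \<Longrightarrow>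
       (\<And>x. m1 x \<in> {lo..hi}) \<Longrightarrow> (\<And>x. m2 x \<in> {lo..hi}) \<Longrightarrow>
       (\<And>x. \<bar>conv_T G1 m2 x - conv_T G2 m2 x\<bar> + \<bar>V1 x - V2 x\<bar> \<le> D) \<Longrightarrow>
       \<bar>H1 - H2\<bar> \<le> C * D \<and> (\<forall>x. \<bar>m1 x - m2 x\<bar> \<le> C * D)"
proof -
  obtain l L where l: "l > 0" and L: "L > 0"
    and slope: "\<And>a b. a \<in> {lo..hi} \<Longrightarrow> b \<in> {lo..hi} \<Longrightarrow>
      \<exists>r. l \<le> r \<and> r \<le> L \<and> c / a powr \<alpha> - c / b powr \<alpha> = - r * (a - b)"
    using coupling_slope[OF assms(1,2)] by metis
  \<comment> \<open>The constants follow the chain of estimates for \<open>f = m1 - m2\<close>: its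
    L1 norm is at most \<open>D / l\<close>, so
    \<open>\<bar>conv_T G1 f x\<bar> \<le> B * D / l\<close>; averaging gives
    \<open>\<bar>H1 - H2\<bar> \<le> CH * D\<close>; dividing the sum of all terms by
    \<open>l\<close> bounds \<open>f\<close> itself.\<close>
  define CH where "CH = (L + B) / l + 1"
  define C where "C = max CH ((B / l + 1 + CH) / l)"
  have CH: "CH > 0"
    using l L assms(3) by (simp add: CH_def add_nonneg_pos)
  show ?thesis
  proof
    show "C > 0"
      using CH by (simp add: C_def less_max_iff_disj)
    fix G1 G2 V1 V2 m1 m2 H1 H2 D
    assume s1: "sol G1 V1 m1 H1" and s2: "sol G2 V2 m2 H2"
      and ct: "CT G1" "CT G2" "CT V1" "CT V2" and M: "cond_M G1" and B: "\<And>x. \<bar>G1 x\<bar> \<le> B"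
      and bd: "\<And>x. m1 x \<in> {lo..hi}" "\<And>x. m2 x \<in> {lo..hi}"
      and D: "\<And>x. \<bar>conv_T G1 m2 x - conv_T G2 m2 x\<bar> + \<bar>V1 x - V2 x\<bar> \<le> D"
    have m: "CT m1" "CT m2" "integral {0..1} m1 = 1" "integral {0..1} m2 = 1"
      using s1 s2 by (auto simp: sol_def)
    define f where "f = (\<lambda>x. m1 x - m2 x)"
    \<comment> \<open>The difference of the kernels is applied to \<open>m2\<close>, so that
      \<open>f\<close> is convolved with \<open>G1\<close>, the kernel to which
      \<open>cond_M\<close> applies. \<open>R\<close> collects the change of data and is bounded by
      \<open>D\<close>.\<close>
    define R where "R = (\<lambda>x. conv_T G1 m2 x - conv_T G2 m2 x + (V2 x - V1 x))"
    define P where "P = (\<lambda>x. conv_T G1 f x + R x + (H1 - H2))"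
    have f: "CT f"
      using m by (auto simp: CT_def f_def periodic1_def intro!: continuous_intros)
    have contf: "continuous_on UNIV f" and contR: "continuous_on UNIV R"
      and contP: "continuous_on UNIV P" and contGf: "continuous_on UNIV (conv_T G1 f)"
      using CT_D[OF f] CT_D(2)[OF ct(1)] CT_D(2)[OF ct(2)] CT_D(2)[OF ct(3)]
        CT_D(2)[OF ct(4)] CT_D(2)[OF m(2)]
      by (auto simp: R_def P_def intro!: continuous_intros continuous_conv_T)
    have int_f: "integral {0..1} f = 0"
      using m continuous_integrable[OF CT_D(2)[OF m(1)]] continuous_integrable[OF CT_D(2)[OF m(2)]]
      by (simp add: f_def Henstock_Kurzweil_Integration.integral_diff)
    have absR: "\<bar>R x\<bar> \<le> D" for x
      using D[of x] abs_triangle_ineq[of "conv_T G1 m2 x - conv_T G2 m2 x" "V2 x - V1 x"]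
      by (simp add: R_def abs_minus_commute)
    have diff: "c / m1 x powr \<alpha> - c / m2 x powr \<alpha> = P x" for x
    proof -
      have "conv_T G1 f x = conv_T G1 m1 x - conv_T G1 m2 x"
        unfolding f_def using CT_D(2)[OF ct(1)] CT_D(2)[OF m(1)] CT_D(2)[OF m(2)] by (rule conv_T_diff_right)
      moreover have "c / m1 x powr \<alpha> + V1 x = conv_T G1 m1 x + H1"
        "c / m2 x powr \<alpha> + V2 x = conv_T G2 m2 x + H2"
        using s1 s2 by (auto simp: sol_def)
      ultimately show ?thesis
        by (simp add: P_def R_def)
    qed
    have slope_f: "\<exists>r. l \<le> r \<and> r \<le> L \<and> P x = - r * f x" for x
      using slope[OF bd(1)[of x] bd(2)[of x]] unfolding diff f_def .
    define n1 where "n1 = integral {0..1} (\<lambda>x. \<bar>f x\<bar>)"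
    define n2 where "n2 = integral {0..1} (\<lambda>x. (f x)\<^sup>2)"
    have n1_nonneg: "0 \<le> n1"
    proof -
      have "continuous_on UNIV (\<lambda>x. \<bar>f x\<bar>)"
        by (intro continuous_intros contf)
      then show ?thesis
        using integral_mono_unit[of "\<lambda>x. 0" "\<lambda>x. \<bar>f x\<bar>"] by (simp add: n1_def)
    qed
    \<comment> \<open>Cauchy-Schwarz on an interval of length one, in the form that the variance of
      \<open>\<bar>f\<bar>\<close> is nonnegative.\<close>
    have CS: "n1\<^sup>2 \<le> n2"
    proof -
      have "0 \<le> integral {0..1} (\<lambda>x. (\<bar>f x\<bar> - n1)\<^sup>2)"
      proof -
        have "continuous_on UNIV (\<lambda>x. (\<bar>f x\<bar> - n1)\<^sup>2)"
          by (intro continuous_intros contf)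
        then show ?thesis
          using integral_mono_unit[of "\<lambda>x. 0" "\<lambda>x. (\<bar>f x\<bar> - n1)\<^sup>2"] by simp
      qed
      also have "(\<lambda>x. (\<bar>f x\<bar> - n1)\<^sup>2) = (\<lambda>x. ((f x)\<^sup>2 - 2 * n1 * \<bar>f x\<bar>) + n1\<^sup>2)"
        by (auto simp: power2_eq_square algebra_simps)
      also have "integral {0..1} \<dots> = n2 - 2 * n1 * n1 + n1\<^sup>2"
        by (simp add: integral_add_unit integral_diff_unit continuous_intros contf
            n2_def n1_def[symmetric])
      finally show ?thesis
        by (simp add: power2_eq_square)
    qed
    have energy: "l * n2 \<le> D * n1"
    proof -
      have iM: "0 \<le> integral {0..1} (\<lambda>x. conv_T G1 f x * f x)"
        using M f by (simp add: cond_M_iff mult.commute)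
      \<comment> \<open>The equation multiplied by \<open>f\<close>, with slope bounded below and
        \<open>R\<close> above. Integration then removes the term with \<open>H1 - H2\<close>, as
        \<open>f\<close> has mean zero.\<close>
      have pw: "conv_T G1 f x * f x - D * \<bar>f x\<bar> + (H1 - H2) * f x \<le> - (l * (f x)\<^sup>2)" for x
      proof -
        obtain r where r: "l \<le> r" "P x = - r * f x"
          using slope_f by blast
        have "l * (f x)\<^sup>2 \<le> r * (f x)\<^sup>2"
          using r by (intro mult_right_mono) auto
        moreover have "P x * f x = - (r * (f x)\<^sup>2)"
          using r by (simp add: power2_eq_square)
        moreover have "\<bar>R x * f x\<bar> \<le> D * \<bar>f x\<bar>"
          using absR by (simp add: abs_mult mult_right_mono)
        ultimately show ?thesis
          by (simp add: P_def algebra_simps)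
      qed
      have "integral {0..1} (\<lambda>x. conv_T G1 f x * f x - D * \<bar>f x\<bar> + (H1 - H2) * f x)
          \<le> integral {0..1} (\<lambda>x. - (l * (f x)\<^sup>2))"
        using contf contGf pw by (intro integral_mono_unit continuous_intros) auto
      moreover have "integral {0..1} (\<lambda>x. - (l * (f x)\<^sup>2)) = - (l * n2)"
        by (simp add: n2_def)
      moreover have "integral {0..1} (\<lambda>x. conv_T G1 f x * f x - D * \<bar>f x\<bar> + (H1 - H2) * f x)
          = integral {0..1} (\<lambda>x. conv_T G1 f x * f x) - D * n1"
        by (simp add: integral_add_unit integral_diff_unit continuous_intros contf contGf int_f
            n1_def)
      ultimately have "integral {0..1} (\<lambda>x. conv_T G1 f x * f x) - D * n1 \<le> - (l * n2)"
        by linarith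
      with iM show ?thesis by simp
    qed
    have D0: "D \<ge> 0"
      using absR[of 0] by simp
    have n1: "n1 \<le> D / l"
    proof (cases "n1 = 0")
      case True
      with D0 l show ?thesis by simp
    next
      case False
      have "l * n1\<^sup>2 \<le> D * n1"
        using mult_left_mono[OF CS, of l] l energy by linarith
      then have "l * n1 \<le> D"
        using False n1_nonneg by (simp add: power2_eq_square)
      with l show ?thesis
        by (simp add: pos_le_divide_eq mult.commute)
    qed
    have absGf: "\<bar>conv_T G1 f x\<bar> \<le> B * D / l" for x
    proof -
      have "\<bar>conv_T G1 f x\<bar> \<le> B * n1"
        unfolding n1_def using CT_D(2)[OF ct(1)] contf B by (rule conv_T_bound)
      also have "\<dots> \<le> B * (D / l)"
        using n1 assms(3) by (rule mult_left_mono)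
      finally show ?thesis by simp
    qed
    \<comment> \<open>No sup bound on \<open>f\<close> is available yet. As \<open>H1 - H2\<close>
      is constant, integrating the pointwise inequality over the period replaces
      \<open>\<bar>f x\<bar>\<close> by the L1 norm, which is already controlled.\<close>
    have H: "\<bar>H1 - H2\<bar> \<le> CH * D"
    proof -
      have "\<bar>(H1 - H2)\<bar> \<le> L * \<bar>f x\<bar> + (B * D / l + D)" for x
      proof -
        obtain r where r: "l \<le> r" "r \<le> L" "P x = - r * f x"
          using slope_f by blast
        have "\<bar>P x\<bar> \<le> L * \<bar>f x\<bar>"
          using r l by (simp add: abs_mult mult_right_mono)
        then show ?thesis
          using absGf[of x] absR[of x] unfolding P_def by linarith
      qed
      then have "integral {0..1} (\<lambda>x::real. \<bar>H1 - H2\<bar>) \<le> integral {0..1} (\<lambda>x. L * \<bar>f x\<bar> + (B * D / l + D))"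
        using contf by (intro integral_mono_unit continuous_intros)
      also have "\<dots> = L * n1 + (B * D / l + D)"
        by (simp add: integral_add_unit continuous_intros contf n1_def[symmetric])
      also have "\<dots> \<le> L * (D / l) + (B * D / l + D)"
        using n1 L by (intro add_mono mult_left_mono) auto
      also have "\<dots> = CH * D"
        by (simp add: CH_def algebra_simps add_divide_distrib)
      finally show ?thesis by simp
    qed
    show "\<bar>H1 - H2\<bar> \<le> C * D \<and> (\<forall>x. \<bar>m1 x - m2 x\<bar> \<le> C * D)"
    proof (intro conjI allI)
      have "CH * D \<le> C * D"
        using D0 by (intro mult_right_mono) (auto simp: C_def)
      with H show "\<bar>H1 - H2\<bar> \<le> C * D" by simp
      fix x
      obtain r where r: "l \<le> r" "P x = - r * f x"
        using slope_f by blast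
      \<comment> \<open>Every term of \<open>P\<close> is now bounded, so the slope from below
        upgrades the integral bound to a pointwise one.\<close>
      have "l * \<bar>f x\<bar> \<le> r * \<bar>f x\<bar>"
        using r by (intro mult_right_mono) auto
      also have "\<dots> = \<bar>P x\<bar>"
        using r l by (simp add: abs_mult)
      also have "\<dots> \<le> B * D / l + D + CH * D"
        using absGf[of x] absR[of x] H unfolding P_def by linarith
      also have "\<dots> = (B / l + 1 + CH) * D"
        by (simp add: algebra_simps)
      finally have "\<bar>f x\<bar> \<le> (B / l + 1 + CH) / l * D"
        using l by (simp add: pos_le_divide_eq mult.commute)
      also have "\<dots> \<le> C * D"
        using D0 by (intro mult_right_mono) (auto simp: C_def)
      finally show "\<bar>m1 x - m2 x\<bar> \<le> C * D"
        by (simp add: f_def)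
    qed
  qed
qed

end

subsection \<open>Existence\<close>

context power_coupling
begin

lemma C11_nonneg:
  assumes "C11 K w"
  shows "K \<ge> 0"
proof -
  obtain w' where "\<And>x y. \<bar>w' x - w' y\<bar> \<le> K * \<bar>x - y\<bar>"
    using assms unfolding C11_def by blast
  from this[of 1 0] show ?thesis by simp
qed

text \<open>The equation identifies the coupling term with \<open>G * m - V + H\<close>, and the
  constant of this function sees neither \<open>m\<close> nor \<open>H\<close>.\<close>

lemma sol_C11:
  assumes "sol G V m H" "C11 K1 G" "C11 K2 V"
  shows "C11 (K1 + K2) (\<lambda>x. c / m x powr \<alpha>)"
proof -
  have "C11 (K1 + \<bar>- 1\<bar> * K2) (\<lambda>x. (conv_T G m x + (- 1) * V x) + H)"
    using assms sol_density by (intro C11_add_const C11_add_scaled C11_conv_T) auto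
  moreover have "conv_T G m x + (- 1) * V x + H = c / m x powr \<alpha>" for x
    using assms(1) by (simp add: sol_def algebra_simps)
  ultimately show ?thesis by simp
qed

text \<open>Without interaction \<open>m = dens (H - V)\<close>, and \<open>H\<close> is fixed by
  the mass. With \<open>V\<close> maximal at \<open>x0\<close>, the mass is at most 1 for
  \<open>H = c + V x0\<close> and at least 1 for \<open>H = \<delta> + V x0\<close> by
  \<open>integral_dens_large\<close>; the intermediate value theorem does the rest.\<close>

lemma sol_zero_kernel_exists:
  assumes "K > 0" "C11 K V"
  shows "\<exists>m H. sol (\<lambda>x. 0) V m H"
proof -
  obtain \<delta> where \<delta>: "0 < \<delta>" "\<delta> \<le> c"
    "\<And>u x0. C11 K u \<Longrightarrow> (\<And>x. 0 < u x) \<Longrightarrow> (\<And>x. u x0 \<le> u x) \<Longrightarrow> u x0 \<le> \<delta> \<Longrightarrow>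
      integral {0..1} (\<lambda>x. dens (u x)) > 1"
    using integral_dens_large[OF assms(1)] by metis
  have "C11 (0 + \<bar>- 1\<bar> * K) (\<lambda>x. 0 + (- 1) * V x)"
    by (intro C11_add_scaled assms) (auto simp: C11_def periodic1_def intro!: exI[of _ "\<lambda>x. 0"])
  then have W: "C11 K (\<lambda>x. - V x)"
    by simp
  then obtain x0 where x0: "\<And>x. - V x0 \<le> - V x"
    using CT_attains_min[OF C11_CT[OF W]] by metis
  have contV: "continuous_on UNIV V"
    using C11_CT[OF assms(2)] by (rule CT_D)
  define I where "I = (\<lambda>H. integral {0..1} (\<lambda>x. dens (H - V x)))"
  have pos: "H - V x > 0" if "H \<ge> \<delta> + V x0" for H x
    using that x0[of x] \<delta>(1) by linarith
  have "I (c + V x0) \<le> integral {0..1} (\<lambda>x::real. 1)"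
    unfolding I_def
  proof (rule integral_mono_unit)
    show "continuous_on UNIV (\<lambda>x. dens (c + V x0 - V x))"
      using pos \<delta> by (intro continuous_dens continuous_intros contV) auto
    show "dens (c + V x0 - V x) \<le> 1" for x
      using dens_antimono[OF c, of "c + V x0 - V x"] x0[of x] by simp
  qed auto
  then have 1: "I (c + V x0) \<le> 1"
    by simp
  have 2: "1 \<le> I (\<delta> + V x0)"
    unfolding I_def
  proof (rule less_imp_le, rule \<delta>(3)[of "\<lambda>x. \<delta> + V x0 - V x" x0])
    have "C11 K (\<lambda>x. - V x + (\<delta> + V x0))"
      by (intro C11_add_const W)
    then show "C11 K (\<lambda>x. \<delta> + V x0 - V x)"
      by (simp add: algebra_simps)
    show "0 < \<delta> + V x0 - V x" for x
      using pos[of "\<delta> + V x0" x] by simp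
    show "\<delta> + V x0 - V x0 \<le> \<delta> + V x0 - V x" for x
      using x0[of x] by simp
  qed auto
  have "continuous_on {\<delta> + V x0..c + V x0} (\<lambda>H. integral (cbox 0 1) (\<lambda>x. dens (H - V x)))"
  proof (rule integral_continuous_on_param)
    show "continuous_on ({\<delta> + V x0..c + V x0} \<times> cbox 0 1) (\<lambda>(H, x). dens (H - V x))"
      unfolding split_beta
      by (intro continuous_dens continuous_intros continuous_on_UNIV_compose[OF contV])
        (auto intro!: pos[THEN diff_gt_0_iff_gt[THEN iffD1]])
  qed
  then have "continuous_on {\<delta> + V x0..c + V x0} I"
    by (simp add: I_def)
  then obtain H where H: "H \<ge> \<delta> + V x0" "I H = 1"
    using IVT2'[of I "c + V x0" 1 "\<delta> + V x0"] 1 2 \<delta> by auto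
  note posH = pos[OF H(1)]
  have "C11 K (\<lambda>x. - V x + H)"
    by (intro C11_add_const W)
  then have ct: "CT (\<lambda>x. dens (H - V x))"
    using posH by (intro CT_dens C11_CT[of K]) auto
  have "sol (\<lambda>x. 0) V (\<lambda>x. dens (H - V x)) H"
    unfolding sol_def
  proof (intro conjI allI)
    show "integral {0..1} (\<lambda>x. dens (H - V x)) = 1"
      using H(2) by (simp add: I_def)
    show "0 < dens (H - V x)" for x
      by (intro dens_pos posH)
    then have "c / dens (H - V x) powr \<alpha> = H - V x" for x
      using dens_eq_iff[OF posH[of x], of "dens (H - V x)"] by simp
    then show "c / dens (H - V x) powr \<alpha> + V x
        = conv_T (\<lambda>x. 0) (\<lambda>x. dens (H - V x)) x + H" for x
      by (simp add: conv_T_def)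
  qed (rule ct)
  then show ?thesis by blast
qed

section \<open>Fixed points in the space of densities\<close>

lemma density_T_bcontfun:
  assumes "density_T m"
  shows "apply_bcontfun (Bcontfun m) = m"
proof -
  have "CT m"
    using assms by (simp add: density_T_def)
  then obtain B where "\<And>x. \<bar>m x\<bar> \<le> B"
    using CT_bounded by metis
  then have "m \<in> bcontfun"
    using \<open>CT m\<close> by (intro bcontfun_normI[of _ B]) (auto simp: CT_def)
  then show ?thesis
    by (rule Bcontfun_inverse)
qed

text \<open>Densities form a closed subset of the bounded continuous functions: periodicity and sign
  survive pointwise limits, the mass survives uniform ones. This is the space for Banach's
  theorem.\<close>

lemma complete_density_T: "complete {g :: real \<Rightarrow>\<^sub>C real. density_T (apply_bcontfun g)}"
  unfolding complete_eq_closed closed_sequential_limits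
proof (intro allI impI, elim conjE)
  fix g l
  assume g: "\<forall>n. g n \<in> {g :: real \<Rightarrow>\<^sub>C real. density_T (apply_bcontfun g)}" and "g \<longlonglongrightarrow> l"
  then have ul: "uniform_limit UNIV (\<lambda>n. apply_bcontfun (g n)) (apply_bcontfun l) sequentially"
    using tendsto_bcontfun_uniform_limit by blast
  have lim: "(\<lambda>n. apply_bcontfun (g n) x) \<longlonglongrightarrow> apply_bcontfun l x" for x
    by (rule tendsto_uniform_limitI[OF ul]) simp
  have dens: "density_T (apply_bcontfun (g n))" for n
    using g by simp
  have "apply_bcontfun l (x + 1) = apply_bcontfun l x" for x
    using lim[of "x + 1"] lim[of x] dens
    by (simp add: density_T_def CT_def periodic1_def LIMSEQ_unique)
  moreover have "0 \<le> apply_bcontfun l x" for x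
    using LIMSEQ_le_const[OF lim[of x], of 0] dens by (auto simp: density_T_def)
  moreover have "integral {0..1} (apply_bcontfun l) = 1"
  proof -
    have ul': "uniform_limit {0..1} (\<lambda>n. apply_bcontfun (g n)) (apply_bcontfun l) sequentially"
      using ul by (rule uniform_limit_on_subset) simp
    obtain I J where IJ: "\<And>n. (apply_bcontfun (g n) has_integral I n) {0..1}"
      "(apply_bcontfun l has_integral J) {0..1}" "I \<longlonglongrightarrow> J"
      using uniform_limit_integral[OF ul'] by (metis continuous_on_apply_bcontfun sequentially_bot)
    have "I n = 1" for n
      using dens[of n] IJ(1)[of n] by (auto simp: density_T_def integral_unique)
    then have "I = (\<lambda>n. 1)"
      by auto
    then have "J = 1"
      using IJ(3) by (simp add: LIMSEQ_const_iff)
    with IJ(2) show ?thesis by (simp add: integral_unique)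
  qed
  ultimately show "l \<in> {g. density_T (apply_bcontfun g)}"
    by (auto simp: density_T_def CT_def periodic1_def)
qed

lemma sol_fixed_point:
  assumes "CT G" and base: "density_T f0"
    and ex: "\<And>f. density_T f \<Longrightarrow> \<exists>m H. sol (\<lambda>x. t * G x) (\<lambda>x. V x + (- e) * conv_T G f x) m H"
    and contract: "\<And>f1 f2 m1 m2 H1 H2 D. density_T f1 \<Longrightarrow> density_T f2 \<Longrightarrow>
      sol (\<lambda>x. t * G x) (\<lambda>x. V x + (- e) * conv_T G f1 x) m1 H1 \<Longrightarrow>
      sol (\<lambda>x. t * G x) (\<lambda>x. V x + (- e) * conv_T G f2 x) m2 H2 \<Longrightarrow>
      (\<And>x. \<bar>f1 x - f2 x\<bar> \<le> D) \<Longrightarrow> \<forall>x. \<bar>m1 x - m2 x\<bar> \<le> D / 2"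
  shows "\<exists>m H. sol (\<lambda>x. (t + e) * G x) V m H"
proof -
  define S where "S = {g :: real \<Rightarrow>\<^sub>C real. density_T (apply_bcontfun g)}"
  obtain F where F: "\<And>f. density_T f \<Longrightarrow>
      \<exists>H. sol (\<lambda>x. t * G x) (\<lambda>x. V x + (- e) * conv_T G f x) (F f) H"
    using ex by metis
  define T where "T = (\<lambda>g :: real \<Rightarrow>\<^sub>C real. Bcontfun (F (apply_bcontfun g)) :: real \<Rightarrow>\<^sub>C real)"
  have T: "apply_bcontfun (T g) = F (apply_bcontfun g)" if "g \<in> S" for g
    using that F sol_density density_T_bcontfun unfolding S_def T_def by blast
  have "\<exists>!g\<in>S. T g = g"
  proof (rule Banach_fix)
    show "complete S"
      unfolding S_def by (rule complete_density_T)
    show "S \<noteq> {}"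
      using density_T_bcontfun[OF base] base unfolding S_def
      by (metis (mono_tags, lifting) empty_iff mem_Collect_eq)
    show "T ` S \<subseteq> S"
    proof (rule image_subsetI)
      fix g assume "g \<in> S"
      then have "density_T (apply_bcontfun (T g))"
        using T F sol_density unfolding S_def by fastforce
      then show "T g \<in> S" by (simp add: S_def)
    qed
    show "dist (T g) (T h) \<le> 1 / 2 * dist g h" if "g \<in> S" "h \<in> S" for g h
    proof (rule dist_bound)
      fix x
      have d: "density_T (apply_bcontfun g)" "density_T (apply_bcontfun h)"
        using that by (auto simp: S_def)
      obtain H1 H2 where H: "sol (\<lambda>x. t * G x) (\<lambda>x. V x + (- e) * conv_T G g x) (F g) H1"
        "sol (\<lambda>x. t * G x) (\<lambda>x. V x + (- e) * conv_T G h x) (F h) H2"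
        using F d by metis
      have "\<bar>apply_bcontfun g x - apply_bcontfun h x\<bar> \<le> dist g h" for x
        using dist_bounded[of g x h] by (simp add: dist_real_def)
      then have "\<forall>x. \<bar>F g x - F h x\<bar> \<le> dist g h / 2"
        using contract[OF d H] by blast
      then show "dist (apply_bcontfun (T g) x) (apply_bcontfun (T h) x) \<le> 1 / 2 * dist g h"
        using T that by (simp add: dist_real_def)
    qed
  qed auto
  then obtain g where "g \<in> S" "T g = g"
    by blast
  then have d: "density_T g" and Fg: "F g = g"
    using T[of g] by (auto simp: S_def)
  then obtain H where "sol (\<lambda>x. t * G x) (\<lambda>x. V x + (- e) * conv_T G g x) g H"
    using F by metis
  then have "sol (\<lambda>x. (t + e) * G x) V g H"
    unfolding sol_def conv_T_scale_left by (auto simp: algebra_simps)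
  then show ?thesis by blast
qed

text \<open>Continuation along the kernels \<open>t G\<close>, \<open>0 \<le> t \<le> 1\<close>, in steps of length \<open>1 / N\<close>. The extra
  part of the kernel is put into the potential; the a priori bounds are uniform in \<open>t\<close>, so that
  one \<open>N\<close> makes each step a contraction.\<close>

lemma sol_exists:
  assumes "C11 KG G" "C11 KV V" "cond_M G"
  shows "\<exists>m H. sol G V m H"
proof -
  have nonneg: "KG \<ge> 0" "KV \<ge> 0"
    using assms C11_nonneg by blast+
  \<comment> \<open>The summand 1 makes \<open>K\<close> positive even for constant data.\<close>
  define K where "K = KG + KV + 1"
  have "K > 0"
    using nonneg by (simp add: K_def)
  then obtain \<delta> M where \<delta>: "0 < \<delta>" "\<delta> \<le> M"
    and apriori: "\<And>u m. C11 K u \<Longrightarrow> CT m \<Longrightarrow> (\<And>x. 0 < m x) \<Longrightarrow> integral {0..1} m = 1 \<Longrightarrow>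
      (\<And>x. c / m x powr \<alpha> = u x) \<Longrightarrow> \<forall>x. u x \<in> {\<delta>..M} \<and> m x \<in> {dens M..dens \<delta>}"
    using a_priori_bounds by metis
  have ctG: "CT G"
    using assms by (intro C11_CT)
  then obtain B where B: "B > 0" "\<And>x. \<bar>G x\<bar> \<le> B"
    using CT_bounded by metis
  have "0 < dens M" "dens M \<le> dens \<delta>"
    using \<delta> by (auto intro: dens_pos dens_antimono)
  then obtain C where C: "C > 0" and stab:
    "\<And>G1 G2 V1 V2 m1 m2 H1 H2 D. sol G1 V1 m1 H1 \<Longrightarrow> sol G2 V2 m2 H2 \<Longrightarrow>
       CT G1 \<Longrightarrow> CT G2 \<Longrightarrow> CT V1 \<Longrightarrow> CT V2 \<Longrightarrow> cond_M G1 \<Longrightarrow> (\<And>x. \<bar>G1 x\<bar> \<le> B) \<Longrightarrow>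
       (\<And>x. m1 x \<in> {dens M..dens \<delta>}) \<Longrightarrow> (\<And>x. m2 x \<in> {dens M..dens \<delta>}) \<Longrightarrow>
       (\<And>x. \<bar>conv_T G1 m2 x - conv_T G2 m2 x\<bar> + \<bar>V1 x - V2 x\<bar> \<le> D) \<Longrightarrow>
       \<bar>H1 - H2\<bar> \<le> C * D \<and> (\<forall>x. \<bar>m1 x - m2 x\<bar> \<le> C * D)"
    using sol_stability[of "dens M" "dens \<delta>" B] B by (metis less_imp_le)
  \<comment> \<open>Freezing turns a distance \<open>D\<close> of densities into a distance
    \<open>e * B * D\<close> of potentials, and stability multiplies it by \<open>C\<close>; a step
    \<open>e = 1 / N\<close> makes the factor at most 1/2.\<close>
  obtain N :: nat where N: "2 * C * B < real N"
    using reals_Archimedean2 by blast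
  moreover have "0 < 2 * C * B"
    using C B by simp
  ultimately have N0: "real N > 0"
    by linarith
  define e where "e = 1 / real N"
  have e: "e > 0" "C * (e * B) \<le> 1 / 2"
    using N N0 by (auto simp: e_def field_simps)
  have scaled: "C11 (t * KG) (\<lambda>x. t * G x)" if "t \<ge> 0" for t
  proof -
    have "C11 (0 + \<bar>t\<bar> * KG) (\<lambda>x. 0 + t * G x)"
      by (intro C11_add_scaled assms) (auto simp: C11_def periodic1_def intro!: exI[of _ "\<lambda>x. 0"])
    with that show ?thesis by simp
  qed
  have "\<forall>V. C11 (K - real n * e * KG) V \<longrightarrow> (\<exists>m H. sol (\<lambda>x. (real n * e) * G x) V m H)" if "n \<le> N" for n
    using that
  proof (induction n)
    case 0
    then show ?case
      using sol_zero_kernel_exists[OF \<open>K > 0\<close>] by simp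
  next
    case (Suc n)
    define t where "t = real n * e"
    have t: "t \<ge> 0" "t \<le> 1" "real (Suc n) * e = t + e"
      using e Suc.prems N0 by (auto simp: t_def e_def field_simps)
    show ?case
    proof (intro allI impI)
      fix V assume V: "C11 (K - real (Suc n) * e * KG) V"
      have V': "C11 (K - t * KG) (\<lambda>x. V x + (- e) * conv_T G f x)" if "density_T f" for f
      proof -
        have "K - real (Suc n) * e * KG + \<bar>- e\<bar> * KG = K - t * KG"
          using e t(3) by (simp add: algebra_simps)
        then show ?thesis
          using C11_add_scaled[OF V C11_conv_T[OF assms(1) that], of "- e"] by (simp only:)
      qed
      have ex: "\<exists>m H. sol (\<lambda>x. t * G x) (\<lambda>x. V x + (- e) * conv_T G f x) m H" if "density_T f" for f
        using Suc V'[OF that] by (auto simp: t_def)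
      have bound: "\<forall>x. m x \<in> {dens M..dens \<delta>}"
        if "density_T f" "sol (\<lambda>x. t * G x) (\<lambda>x. V x + (- e) * conv_T G f x) m H" for f m H
      proof -
        have "C11 K (\<lambda>x. c / m x powr \<alpha>)"
          using sol_C11[OF that(2) scaled[OF t(1)] V'[OF that(1)]] by simp
        then show ?thesis
          using apriori[of "\<lambda>x. c / m x powr \<alpha>" m] that(2) by (auto simp: sol_def)
      qed
      have "\<exists>m H. sol (\<lambda>x. (t + e) * G x) V m H"
      proof (rule sol_fixed_point[OF ctG _ ex])
        show "density_T (\<lambda>x. 1)"
          by (auto simp: density_T_def CT_def periodic1_def)
      next
        fix f1 f2 m1 m2 :: "real \<Rightarrow> real" and H1 H2 D :: real
        assume f: "density_T f1" "density_T f2"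
          and s: "sol (\<lambda>x. t * G x) (\<lambda>x. V x + (- e) * conv_T G f1 x) m1 H1"
            "sol (\<lambda>x. t * G x) (\<lambda>x. V x + (- e) * conv_T G f2 x) m2 H2"
          and D: "\<And>x. \<bar>f1 x - f2 x\<bar> \<le> D"
        have fc: "continuous_on UNIV f1" "continuous_on UNIV f2"
          using f by (auto simp: density_T_def CT_def)
        have "\<bar>conv_T G f1 x - conv_T G f2 x\<bar> \<le> B * D" for x
        proof -
          have "\<bar>conv_T G (\<lambda>y. f1 y - f2 y) x\<bar> \<le> B * integral {0..1} (\<lambda>y. \<bar>f1 y - f2 y\<bar>)"
            using CT_D(2)[OF ctG] fc B(2) by (intro conv_T_bound continuous_intros)
          also have "\<dots> \<le> B * integral {0..1} (\<lambda>y::real. D)"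
            using B(1) fc D by (intro mult_left_mono integral_mono_unit continuous_intros) auto
          finally show ?thesis
            using conv_T_diff_right[OF CT_D(2)[OF ctG] fc] by simp
        qed
        then have "\<bar>(V x + (- e) * conv_T G f1 x) - (V x + (- e) * conv_T G f2 x)\<bar> \<le> e * (B * D)" for x
        proof -
          have "(V x + (- e) * conv_T G f1 x) - (V x + (- e) * conv_T G f2 x)
              = (- e) * (conv_T G f1 x - conv_T G f2 x)"
            by (simp add: algebra_simps)
          then show ?thesis
            using e(1) mult_left_mono[OF \<open>\<And>x. \<bar>conv_T G f1 x - conv_T G f2 x\<bar> \<le> B * D\<close>[of x], of e]
            by (simp only: abs_mult abs_minus_cancel abs_of_pos less_imp_le)
        qed
        then have "\<bar>conv_T (\<lambda>x. t * G x) m2 x - conv_T (\<lambda>x. t * G x) m2 x\<bar>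
            + \<bar>(V x + (- e) * conv_T G f1 x) - (V x + (- e) * conv_T G f2 x)\<bar> \<le> e * (B * D)" for x
          by simp
        moreover have "\<bar>t * G x\<bar> \<le> B" for x
          using B(2)[of x] t mult_mono[of t 1 "\<bar>G x\<bar>" B] by (simp add: abs_mult)
        moreover have "CT (\<lambda>x. t * G x)"
          using scaled[OF t(1)] by (rule C11_CT)
        ultimately have le: "\<forall>x. \<bar>m1 x - m2 x\<bar> \<le> C * (e * (B * D))"
          using stab[OF s _ _ C11_CT[OF V'[OF f(1)]] C11_CT[OF V'[OF f(2)]] cond_M_scale[OF assms(3) t(1)]]
            bound[OF f(1) s(1)] bound[OF f(2) s(2)] by blast
        have "D \<ge> 0"
          using D[of 0] by simp
        then have "C * (e * B) * D \<le> 1 / 2 * D"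
          using e(2) by (intro mult_right_mono)
        then have "C * (e * (B * D)) \<le> D / 2"
          by (simp add: mult.assoc)
        with le show "\<forall>x. \<bar>m1 x - m2 x\<bar> \<le> D / 2"
          by (meson order_trans)
      qed
      then show "\<exists>m H. sol (\<lambda>x. (real (Suc n) * e) * G x) V m H"
        unfolding t(3) .
    qed
  qed
  from this[of N] have "\<forall>V. C11 (K - KG) V \<longrightarrow> (\<exists>m H. sol G V m H)"
    using N0 by (simp add: e_def)
  moreover have "C11 (K - KG) V"
    using assms(2) by (rule C11_mono) (simp add: K_def)
  ultimately show ?thesis by blast
qed

end

subsection \<open>Fejer means\<close>

lemma has_integral_cos_freq:
  "((\<lambda>x. cos (2 * pi * of_int i * x)) has_integral (if i = 0 then 1 else 0)) {0..1}"
proof (cases "i = 0")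
  case True
  then show ?thesis
    using has_integral_const_real[of "1::real" 0 1] by simp
next
  case False
  define w where "w = 2 * pi * of_int i"
  have w: "w \<noteq> 0" "sin w = 0"
    using False sin_npi_int[of "2 * i"] by (simp_all add: w_def mult_ac)
  have "((\<lambda>x. cos (w * x)) has_integral (sin (w * 1) / w - sin (w * 0) / w)) {0..1}"
    using w(1) by (intro fundamental_theorem_of_calculus)
      (auto simp: has_real_derivative_iff_has_vector_derivative[symmetric] intro!: derivative_eq_intros)
  with False w show ?thesis
    by (simp add: w_def)
qed

lemma has_integral_sin_freq:
  "((\<lambda>x. sin (2 * pi * of_int i * x)) has_integral 0) {0..1}"
proof (cases "i = 0")
  case False
  define w where "w = 2 * pi * of_int i"
  have w: "w \<noteq> 0" "cos w = 1"
    using False cos_int_2pin[of i] by (simp_all add: w_def mult_ac)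
  have "((\<lambda>x. sin (w * x)) has_integral (- cos (w * 1) / w - (- cos (w * 0) / w))) {0..1}"
    using w(1) by (intro fundamental_theorem_of_calculus)
      (auto simp: has_real_derivative_iff_has_vector_derivative[symmetric] intro!: derivative_eq_intros)
  with False w show ?thesis
    by (simp add: w_def)
qed simp

text \<open>Grouping the pairs by \<open>j = k - l\<close> gives the usual weights
  \<open>1 - \<bar>j\<bar> / n\<close> for \<open>\<bar>j\<bar> < n\<close>. The ungrouped form
  makes nonnegativity visible and avoids counting.\<close>

definition fejer :: "nat \<Rightarrow> real \<Rightarrow> real" where
  "fejer n x = (\<Sum>(k, l)\<in>{..<n} \<times> {..<n}. cos (2 * pi * of_int (int k - int l) * x)) / real n"

lemma continuous_fejer: "continuous_on UNIV (fejer n)"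
  unfolding fejer_def divide_inverse by (intro continuous_intros continuous_on_sum)
    (auto simp: split_beta intro!: continuous_intros)

lemma cos_freq_periodic:
  "cos (2 * pi * of_int i * (x + 1)) = cos (2 * pi * of_int i * x)"
  using cos_int_2pin[of i] sin_int_2pin[of i] by (simp add: ring_distribs cos_add mult_ac)

lemma CT_cos_freq: "CT (\<lambda>x. cos (2 * pi * of_int i * x))"
  by (auto simp: CT_def periodic1_def cos_freq_periodic simp del: of_int_mult intro!: continuous_intros)

lemma CT_fejer: "CT (fejer n)"
proof -
  have "fejer n (x + 1) = fejer n x" for x
    by (simp only: fejer_def cos_freq_periodic)
  then show ?thesis
    by (simp add: CT_def periodic1_def continuous_fejer)
qed

text \<open>The double sum is the squared modulus of the sum of \<open>exp (2 pi i k x)\<close> over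
  \<open>k < n\<close>, here split into real and imaginary parts.\<close>

lemma fejer_nonneg: "0 \<le> fejer n x"
proof -
  have "(\<Sum>(k, l)\<in>{..<n} \<times> {..<n}. cos (2 * pi * of_int (int k - int l) * x))
      = (\<Sum>k<n. \<Sum>l<n. cos (2 * pi * real k * x) * cos (2 * pi * real l * x)
          + sin (2 * pi * real k * x) * sin (2 * pi * real l * x))"
    unfolding sum.cartesian_product[symmetric]
    by (intro sum.cong refl) (simp add: cos_diff[symmetric] algebra_simps)
  also have "\<dots> = (\<Sum>k<n. cos (2 * pi * real k * x))\<^sup>2 + (\<Sum>k<n. sin (2 * pi * real k * x))\<^sup>2"
    by (simp add: power2_eq_square sum_product sum.distrib)
  finally show ?thesis
    by (simp add: fejer_def)
qed

lemma has_integral_fejer_mult: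
  assumes "\<And>k l. k < n \<Longrightarrow> l < n \<Longrightarrow>
    ((\<lambda>x. cos (2 * pi * of_int (int k - int l) * x) * g x) has_integral I k l) {0..1}"
  shows "((\<lambda>x. fejer n x * g x) has_integral (\<Sum>k<n. \<Sum>l<n. I k l) / real n) {0..1}"
proof -
  have "((\<lambda>x. \<Sum>p\<in>{..<n} \<times> {..<n}. cos (2 * pi * of_int (int (fst p) - int (snd p)) * x) * g x)
      has_integral (\<Sum>p\<in>{..<n} \<times> {..<n}. I (fst p) (snd p))) {0..1}"
    using assms by (intro has_integral_sum) auto
  then have "((\<lambda>x. (\<Sum>p\<in>{..<n} \<times> {..<n}. cos (2 * pi * of_int (int (fst p) - int (snd p)) * x) * g x) / real n)
      has_integral (\<Sum>p\<in>{..<n} \<times> {..<n}. I (fst p) (snd p)) / real n) {0..1}"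
    by (rule has_integral_divide)
  then show ?thesis
    by (simp add: fejer_def split_beta sum.cartesian_product sum_distrib_right)
qed

lemma integral_fejer:
  assumes "n > 0"
  shows "integral {0..1} (fejer n) = 1"
proof -
  have "((\<lambda>x. fejer n x * 1) has_integral (\<Sum>k<n. \<Sum>l<n. if int k - int l = 0 then 1 else 0) / real n) {0..1}"
    by (rule has_integral_fejer_mult, simp only: mult_1_right, rule has_integral_cos_freq)
  moreover have "(\<Sum>k<n. \<Sum>l<n. if int k - int l = 0 then 1 else 0) = real n"
    by (simp add: sum.delta)
  ultimately show ?thesis
    using assms by (simp add: integral_unique)
qed

text \<open>Only pairs with \<open>k - l\<close> equal to 1 or -1 contribute, \<open>n\<close> pairs
  of each sign with weight 1/2. So \<open>1 - cos (2 * pi * x)\<close>, the test function of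
  Korovkin's argument, has integral \<open>1 / (n + 1)\<close> against the kernel.\<close>

lemma integral_fejer_cos:
  "integral {0..1} (\<lambda>x. fejer (Suc n) x * cos (2 * pi * x)) = real n / real (Suc n)"
proof -
  have "((\<lambda>x. fejer (Suc n) x * cos (2 * pi * x)) has_integral
      (\<Sum>k<Suc n. \<Sum>l<Suc n. ((if l = Suc k then 1 else 0) + (if k = Suc l then 1 else 0)) / 2)
        / real (Suc n)) {0..1}"
  proof (rule has_integral_fejer_mult)
    fix k l :: nat
    define i where "i = int k - int l"
    have "((\<lambda>x. (cos (2 * pi * of_int (i + 1) * x) + cos (2 * pi * of_int (i - 1) * x)) / 2)
        has_integral ((if i + 1 = 0 then 1 else 0) + (if i - 1 = 0 then 1 else 0)) / 2) {0..1}"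
      by (intro has_integral_divide has_integral_add has_integral_cos_freq)
    moreover have "(cos (2 * pi * of_int (i + 1) * x) + cos (2 * pi * of_int (i - 1) * x)) / 2
        = cos (2 * pi * of_int i * x) * cos (2 * pi * x)" for x
      by (simp add: cos_add cos_diff ring_distribs)
    moreover have "i + 1 = 0 \<longleftrightarrow> l = Suc k" "i - 1 = 0 \<longleftrightarrow> k = Suc l"
      by (auto simp: i_def)
    ultimately show "((\<lambda>x. cos (2 * pi * of_int (int k - int l) * x) * cos (2 * pi * x)) has_integral
        ((if l = Suc k then 1 else 0) + (if k = Suc l then 1 else 0)) / 2) {0..1}"
      by (simp add: i_def)
  qed
  moreover have "(\<Sum>k<Suc n. \<Sum>l<Suc n. ((if l = Suc k then 1 else 0) + (if k = Suc l then 1 else 0)) / 2 :: real) = real n"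
  proof -
    have "(\<Sum>k<Suc n. \<Sum>l<Suc n. if l = Suc k then 1 else 0 :: real) = (\<Sum>k<Suc n. if k < n then 1 else 0)"
      by (intro sum.cong refl, subst sum.delta) auto
    also have "\<dots> = (\<Sum>k<n. 1)"
      by (intro sum.mono_neutral_cong_right) auto
    finally have *: "(\<Sum>k<Suc n. \<Sum>l<Suc n. if l = Suc k then 1 else 0 :: real) = real n"
      by simp
    then have "(\<Sum>k<Suc n. \<Sum>l<Suc n. if k = Suc l then 1 else 0 :: real) = real n"
      by (subst sum.swap)
    with * show ?thesis
      by (simp only: sum_divide_distrib[symmetric] sum.distrib) simp
  qed
  ultimately show ?thesis
    by (metis integral_unique)
qed

lemma density_fejer: "density_T (fejer (Suc n))"
  by (simp add: density_T_def CT_fejer fejer_nonneg integral_fejer)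

lemma one_minus_cos_lower:
  assumes "0 < d" "d \<le> 1 / 2" "y \<in> {d..1 - d}"
  shows "1 - cos (2 * pi * d) \<le> 1 - cos (2 * pi * y)"
proof (cases "y \<le> 1 / 2")
  case True
  then have "cos (2 * pi * y) \<le> cos (2 * pi * d)"
    using assms by (intro cos_monotone_0_pi_le) auto
  then show ?thesis by simp
next
  case False
  then have "cos (2 * pi * (1 - y)) \<le> cos (2 * pi * d)"
    using assms by (intro cos_monotone_0_pi_le) auto
  moreover have "cos (2 * pi * (1 - y)) = cos (2 * pi * y)"
    by (simp add: right_diff_distrib cos_diff)
  ultimately show ?thesis by simp
qed

text \<open>Korovkin's argument: away from the integers \<open>1 - cos (2 \<pi> y)\<close> is bounded below, so it dominates
  the increments of \<open>g\<close> up to \<open>e\<close>, and the kernel nearly annihilates it.\<close>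

lemma fejer_uniform_limit:
  assumes g: "CT g"
  shows "uniform_limit UNIV (\<lambda>n. conv_T g (fejer (Suc n))) g sequentially"
proof (rule uniform_limitI)
  fix e :: real assume e: "e > 0"
  obtain d0 where d0: "d0 > 0" "\<And>x y. \<bar>x - y\<bar> < d0 \<Longrightarrow> \<bar>g x - g y\<bar> < e / 2"
    using CT_uniform_continuity[OF g, of "e / 2"] e by auto
  obtain B where B: "B > 0" "\<And>x. \<bar>g x\<bar> \<le> B"
    using CT_bounded[OF g] by metis
  define d where "d = min d0 (1 / 2)"
  have d: "0 < d" "d \<le> 1 / 2" "d \<le> d0"
    using d0 by (auto simp: d_def)
  define h where "h = 1 - cos (2 * pi * d)"
  have h: "h > 0"
    using cos_monotone_0_pi[of 0 "2 * pi * d"] d by (simp add: h_def)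
  \<comment> \<open>Chosen such that \<open>C * h\<close> equals \<open>2 * B\<close>, the trivial
    bound for an increment of \<open>g\<close>.\<close>
  define C where "C = 2 * B / h"
  have C: "C > 0"
    using B h by (simp add: C_def)
  have incr: "\<bar>g (x - y) - g x\<bar> \<le> e / 2 + C * (1 - cos (2 * pi * y))" if y: "y \<in> {0..1}" for x y
  proof -
    have nn: "0 \<le> C * (1 - cos (2 * pi * y))"
      using C by simp
    consider "y < d" | "y > 1 - d" | "y \<in> {d..1 - d}"
      by fastforce
    then show ?thesis
    proof cases
      case 1
      then have "\<bar>g (x - y) - g x\<bar> < e / 2"
        using d y by (intro d0(2)) auto
      with nn show ?thesis by simp
    next
      case 2
      \<comment> \<open>Near the right end of the period \<open>y\<close> is close to the integer 1,
        so one shift makes the increment small.\<close>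
      have "g (x - y) = g (x - y + 1)"
        using CT_D(1)[OF g] by (simp add: periodic1_def)
      moreover have "\<bar>g (x - y + 1) - g x\<bar> < e / 2"
        using 2 d y by (intro d0(2)) auto
      ultimately show ?thesis
        using nn by simp
    next
      case 3
      have "C * h \<le> C * (1 - cos (2 * pi * y))"
        using C one_minus_cos_lower[OF d(1,2) 3] by (intro mult_left_mono) (auto simp: h_def)
      moreover have "\<bar>g (x - y) - g x\<bar> \<le> 2 * B"
        using B(2)[of x] B(2)[of "x - y"] by linarith
      moreover have "C * h = 2 * B"
        using h by (simp add: C_def)
      ultimately show ?thesis
        using e by linarith
    qed
  qed
  have est: "\<bar>conv_T g (fejer (Suc n)) x - g x\<bar> \<le> e / 2 + C / real (Suc n)" for n x
  proof -
    let ?F = "fejer (Suc n)"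
    have cg: "continuous_on UNIV (\<lambda>y. g (x - y))"
      by (intro continuous_on_UNIV_compose[OF CT_D(2)[OF g]] continuous_intros)
    have "conv_T g ?F x - g x = integral {0..1} (\<lambda>y. g (x - y) * ?F y) - integral {0..1} (\<lambda>y. g x * ?F y)"
      using integral_fejer[of "Suc n"] by (simp add: conv_T_def)
    also have "\<dots> = integral {0..1} (\<lambda>y. (g (x - y) - g x) * ?F y)"
      by (subst integral_diff_unit[symmetric])
        (auto simp: left_diff_distrib intro!: continuous_intros cg continuous_fejer)
    also have "\<bar>\<dots>\<bar> \<le> integral {0..1} (\<lambda>y. (e / 2 + C * (1 - cos (2 * pi * y))) * ?F y)"
    proof (rule abs_integral_le)
      show "\<bar>(g (x - y) - g x) * ?F y\<bar> \<le> (e / 2 + C * (1 - cos (2 * pi * y))) * ?F y"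
        if "y \<in> {0..1}" for y
        using incr[OF that, of x] fejer_nonneg[of "Suc n" y]
        by (simp only: abs_mult abs_of_nonneg mult_right_mono)
    qed (intro continuous_intros cg continuous_fejer)+
    also have "(\<lambda>y. (e / 2 + C * (1 - cos (2 * pi * y))) * ?F y)
        = (\<lambda>y. (e / 2 + C) * ?F y - C * (?F y * cos (2 * pi * y)))"
      by (auto simp: algebra_simps)
    also have "integral {0..1} \<dots> = (e / 2 + C) - C * (real n / real (Suc n))"
      by (subst integral_diff_unit)
        (auto simp: integral_fejer integral_fejer_cos intro!: continuous_intros continuous_fejer)
    also have "\<dots> = e / 2 + C / real (Suc n)"
      by (simp add: field_simps)
    finally show ?thesis .
  qed
  have "(\<lambda>n. C * inverse (real (Suc n))) \<longlonglongrightarrow> C * 0"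
    by (intro tendsto_intros LIMSEQ_inverse_real_of_nat)
  then have "\<forall>\<^sub>F n in sequentially. C * inverse (real (Suc n)) < e / 2"
    by (rule order_tendstoD) (use e in simp)
  then show "\<forall>\<^sub>F n in sequentially. \<forall>x\<in>UNIV. dist (conv_T g (fejer (Suc n)) x) (g x) < e"
  proof eventually_elim
    case (elim n)
    show ?case
    proof
      fix x
      show "dist (conv_T g (fejer (Suc n)) x) (g x) < e"
        using est[of n x] elim unfolding dist_real_def divide_inverse[of C] by linarith
    qed
  qed
qed

section \<open>Fejer means as trigonometric polynomials, and their inheritance of (M) and of the
  mean value\<close>

lemma trig_poly_add:
  assumes "trig_poly f" "trig_poly g"
  shows "trig_poly (\<lambda>x. f x + g x)"
proof -
  obtain N1 a1 b1 where 1: "\<And>x. f x = (\<Sum>k\<le>N1::nat. a1 k * cos (2 * pi * real k * x) + b1 k * sin (2 * pi * real k * x))"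
    using assms(1) unfolding trig_poly_def by blast
  obtain N2 a2 b2 where 2: "\<And>x. g x = (\<Sum>k\<le>N2::nat. a2 k * cos (2 * pi * real k * x) + b2 k * sin (2 * pi * real k * x))"
    using assms(2) unfolding trig_poly_def by blast
  have extend: "(\<Sum>k\<le>N::nat. a k * cos (2 * pi * real k * x) + b k * sin (2 * pi * real k * x))
      = (\<Sum>k\<le>max N1 N2. (if k \<le> N then a k else 0) * cos (2 * pi * real k * x)
          + (if k \<le> N then b k else 0) * sin (2 * pi * real k * x))"
    if "N \<le> max N1 N2" for N a b x
    using that by (intro sum.mono_neutral_cong_left) auto
  show ?thesis
    unfolding trig_poly_def
    by (intro exI[of _ "max N1 N2"]
        exI[of _ "\<lambda>k. (if k \<le> N1 then a1 k else 0) + (if k \<le> N2 then a2 k else 0)"]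
        exI[of _ "\<lambda>k. (if k \<le> N1 then b1 k else 0) + (if k \<le> N2 then b2 k else 0)"] allI)
      (simp only: 1 2 extend[of N1] extend[of N2] max.cobounded1 max.cobounded2
        sum.distrib[symmetric] ring_distribs add_ac)
qed

lemma trig_poly_scale:
  assumes "trig_poly f"
  shows "trig_poly (\<lambda>x. r * f x)"
proof -
  obtain N a b where "\<And>x. f x = (\<Sum>k\<le>N::nat. a k * cos (2 * pi * real k * x) + b k * sin (2 * pi * real k * x))"
    using assms unfolding trig_poly_def by blast
  then show ?thesis
    unfolding trig_poly_def
    by (intro exI[of _ N] exI[of _ "\<lambda>k. r * a k"] exI[of _ "\<lambda>k. r * b k"])
      (simp add: sum_distrib_left ring_distribs mult.assoc)
qed

lemma trig_poly_wave:
  "trig_poly (\<lambda>x. a * cos (2 * pi * of_int i * x) + b * sin (2 * pi * of_int i * x))"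
proof -
  have nat: "trig_poly (\<lambda>x. a * cos (2 * pi * real n * x) + b * sin (2 * pi * real n * x))" for n a b
    unfolding trig_poly_def
    by (intro exI[of _ n] exI[of _ "\<lambda>k. if k = n then a else 0"] exI[of _ "\<lambda>k. if k = n then b else 0"])
      (simp add: if_distrib[of "\<lambda>c. c * _"] sum.distrib cong: if_cong)
  show ?thesis
  proof (cases "i \<ge> 0")
    case True
    then show ?thesis
      using nat[of a "nat i" b] by simp
  next
    case False
    then show ?thesis
      \<comment> \<open>A negative frequency is reflected; the sine is odd, so its coefficient
        changes sign.\<close>
      using nat[of a "nat (- i)" "- b"] by simp
  qed
qed

lemma trig_poly_sum:
  assumes "\<And>p. p \<in> S \<Longrightarrow> trig_poly (f p)"
  shows "trig_poly (\<lambda>x. \<Sum>p\<in>S. f p x)"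
  using assms
proof (induction S rule: infinite_finite_induct)
  case (insert p S)
  then show ?case
    by (simp add: trig_poly_add)
next
  case empty
  then show ?case
    using trig_poly_wave[of 0 0 0] by simp
next
  case (infinite S)
  then show ?case
    using trig_poly_wave[of 0 0 0] by simp
qed

text \<open>By the addition theorems the quadratic form is
  \<open>a * (P\<^sup>2 + Q\<^sup>2)\<close>, where \<open>P\<close> and \<open>Q\<close> are the
  cosine and sine integrals of \<open>f\<close>; the odd part of the kernel cancels.\<close>

lemma cond_M_wave:
  assumes "a \<ge> 0"
  shows "cond_M (\<lambda>x. a * cos (w * x) + b * sin (w * x))"
  unfolding cond_M_iff
proof (intro allI impI)
  fix f assume "CT f"
  then have f: "continuous_on UNIV f"
    by (rule CT_D)
  define P where "P = integral {0..1} (\<lambda>y. f y * cos (w * y))"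
  define Q where "Q = integral {0..1} (\<lambda>y. f y * sin (w * y))"
  have conv: "conv_T (\<lambda>x. a * cos (w * x) + b * sin (w * x)) f x
      = (a * cos (w * x) + b * sin (w * x)) * P + (a * sin (w * x) - b * cos (w * x)) * Q" for x
  proof -
    have "(\<lambda>y. (a * cos (w * (x - y)) + b * sin (w * (x - y))) * f y)
        = (\<lambda>y. (a * cos (w * x) + b * sin (w * x)) * (f y * cos (w * y))
            + (a * sin (w * x) - b * cos (w * x)) * (f y * sin (w * y)))"
      by (auto simp: right_diff_distrib cos_diff sin_diff algebra_simps)
    then show ?thesis
      by (simp add: conv_T_def integral_add_unit continuous_intros f P_def[symmetric] Q_def[symmetric])
  qed
  have "(\<lambda>x. f x * conv_T (\<lambda>x. a * cos (w * x) + b * sin (w * x)) f x)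
      = (\<lambda>x. (a * P - b * Q) * (f x * cos (w * x)) + (b * P + a * Q) * (f x * sin (w * x)))"
    by (rule ext, simp only: conv) (simp add: algebra_simps)
  then have "integral {0..1} (\<lambda>x. f x * conv_T (\<lambda>x. a * cos (w * x) + b * sin (w * x)) f x)
      = (a * P - b * Q) * P + (b * P + a * Q) * Q"
    by (simp add: integral_add_unit continuous_intros f P_def[symmetric] Q_def[symmetric])
  also have "\<dots> = a * (P\<^sup>2 + Q\<^sup>2)"
    by (simp add: power2_eq_square algebra_simps)
  also have "\<dots> \<ge> 0"
    using assms by simp
  finally show "0 \<le> integral {0..1} (\<lambda>x. f x * conv_T (\<lambda>x. a * cos (w * x) + b * sin (w * x)) f x)" .
qed

lemma cond_M_add:
  assumes "continuous_on UNIV f" "continuous_on UNIV g" "cond_M f" "cond_M g"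
  shows "cond_M (\<lambda>x. f x + g x)"
  unfolding cond_M_iff
proof (intro allI impI)
  fix h assume h: "CT h"
  then have hc: "continuous_on UNIV h"
    by (rule CT_D)
  have "conv_T (\<lambda>x. f x + g x) h x = conv_T f h x + conv_T g h x" for x
    by (simp add: conv_T_def distrib_right integral_add_unit continuous_conv_integrand assms hc)
  then have "integral {0..1} (\<lambda>x. h x * conv_T (\<lambda>x. f x + g x) h x)
      = integral {0..1} (\<lambda>x. h x * conv_T f h x) + integral {0..1} (\<lambda>x. h x * conv_T g h x)"
    by (simp add: distrib_left integral_add_unit continuous_intros continuous_conv_T assms hc)
  with assms(3,4) h show "0 \<le> integral {0..1} (\<lambda>x. h x * conv_T (\<lambda>x. f x + g x) h x)"
    by (simp add: cond_M_iff)
qed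

lemma cond_M_sum:
  assumes "finite S" "\<And>p. p \<in> S \<Longrightarrow> cond_M (f p)" "\<And>p. p \<in> S \<Longrightarrow> continuous_on UNIV (f p)"
  shows "cond_M (\<lambda>x. \<Sum>p\<in>S. f p x)"
  using assms
proof (induction S rule: finite_induct)
  case empty
  then show ?case
    by (simp add: cond_M_def)
next
  case (insert p S)
  then show ?case
    by (simp add: cond_M_add continuous_on_sum)
qed

lemma conv_T_cos_freq:
  assumes "CT G"
  shows "conv_T G (\<lambda>y. cos (2 * pi * of_int i * y)) x
    = integral {0..1} (\<lambda>y. G y * cos (2 * pi * of_int i * y)) * cos (2 * pi * of_int i * x)
      + integral {0..1} (\<lambda>y. G y * sin (2 * pi * of_int i * y)) * sin (2 * pi * of_int i * x)"
proof -
  define w where "w = 2 * pi * of_int i"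
  note G = CT_D(2)[OF assms]
  have "conv_T G (\<lambda>y. cos (w * y)) x = conv_T (\<lambda>y. cos (w * y)) G x"
    using CT_cos_freq[of i] unfolding w_def by (intro conv_T_commute assms)
  also have "\<dots> = integral {0..1} (\<lambda>y. cos (w * x) * (G y * cos (w * y)) + sin (w * x) * (G y * sin (w * y)))"
    by (simp add: conv_T_def right_diff_distrib cos_diff algebra_simps)
  also have "\<dots> = cos (w * x) * integral {0..1} (\<lambda>y. G y * cos (w * y))
      + sin (w * x) * integral {0..1} (\<lambda>y. G y * sin (w * y))"
    by (simp add: integral_add_unit continuous_intros G)
  finally show ?thesis
    by (simp add: w_def mult.commute)
qed

text \<open>Testing (M) with the cosine of this frequency leaves its coefficient times the mean of
  the squared cosine, as the sine part integrates to zero. That mean is 1/2, or 1 at frequency zero;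
  \<open>J\<close> covers both cases.\<close>

lemma cond_M_cos_coeff_nonneg:
  assumes "CT G" "cond_M G"
  shows "0 \<le> integral {0..1} (\<lambda>y. G y * cos (2 * pi * of_int i * y))"
proof -
  define A where "A = integral {0..1} (\<lambda>y. G y * cos (2 * pi * of_int i * y))"
  define B where "B = integral {0..1} (\<lambda>y. G y * sin (2 * pi * of_int i * y))"
  define f where "f = (\<lambda>x. cos (2 * pi * of_int i * x) :: real)"
  define J where "J = (if 2 * i = 0 then 1 else 0 :: real)"
  have "f x * conv_T G f x = A * ((1 + cos (2 * pi * of_int (2 * i) * x)) / 2)
      + B * (sin (2 * pi * of_int (2 * i) * x) / 2)" for x
    unfolding f_def conv_T_cos_freq[OF assms(1)] A_def[symmetric] B_def[symmetric]
    using cos_double_cos[of "2 * pi * of_int i * x"] sin_double[of "2 * pi * of_int i * x"]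
    by (simp add: power2_eq_square algebra_simps)
  moreover have "((\<lambda>x. A * ((1 + cos (2 * pi * of_int (2 * i) * x)) / 2)
      + B * (sin (2 * pi * of_int (2 * i) * x) / 2)) has_integral
        (A * ((1 + J) / 2) + B * (0 / 2))) {0..1}"
    unfolding J_def using has_integral_const_real[of "1::real" 0 1]
    by (intro has_integral_add has_integral_mult_right has_integral_divide
        has_integral_cos_freq has_integral_sin_freq) simp
  ultimately have "integral {0..1} (\<lambda>x. f x * conv_T G f x) = A * ((1 + J) / 2)"
    by (simp add: integral_unique)
  moreover have "0 \<le> integral {0..1} (\<lambda>x. f x * conv_T G f x)"
    using assms(2) CT_cos_freq[of i] unfolding cond_M_iff f_def by blast
  ultimately have "0 \<le> A * ((1 + J) / 2)" by simp
  moreover have "(1 + J) / 2 > 0" by (simp add: J_def)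
  ultimately show ?thesis
    by (simp add: zero_le_mult_iff A_def[symmetric])
qed

text \<open>Each summand is a single wave with the Fourier coefficients of \<open>G\<close>, and the
  weight is nonnegative. Being a trigonometric polynomial, condition (M) and the integral are then
  read off term by term.\<close>

lemma fejer_mean:
  assumes "CT G"
  shows "conv_T G (fejer n) = (\<lambda>x. (1 / real n) * (\<Sum>p\<in>{..<n} \<times> {..<n}.
    integral {0..1} (\<lambda>y. G y * cos (2 * pi * of_int (int (fst p) - int (snd p)) * y))
      * cos (2 * pi * of_int (int (fst p) - int (snd p)) * x)
    + integral {0..1} (\<lambda>y. G y * sin (2 * pi * of_int (int (fst p) - int (snd p)) * y))
      * sin (2 * pi * of_int (int (fst p) - int (snd p)) * x)))"
proof
  fix x
  have cont: "continuous_on UNIV (\<lambda>y. G (x - y) * cos (2 * pi * of_int i * y))" for i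
    using CT_D(2)[OF assms] CT_D(2)[OF CT_cos_freq] by (rule continuous_conv_integrand)
  have "(\<lambda>y. G (x - y) * fejer n y) = (\<lambda>y. (1 / real n) *
      (\<Sum>p\<in>{..<n} \<times> {..<n}. G (x - y) * cos (2 * pi * of_int (int (fst p) - int (snd p)) * y)))"
    by (rule ext) (simp add: fejer_def split_beta sum_distrib_left[symmetric])
  then have "conv_T G (fejer n) x = (1 / real n) * (\<Sum>p\<in>{..<n} \<times> {..<n}.
      conv_T G (\<lambda>y. cos (2 * pi * of_int (int (fst p) - int (snd p)) * y)) x)"
    unfolding conv_T_def
    by (simp only: Henstock_Kurzweil_Integration.integral_mult_right
        Henstock_Kurzweil_Integration.integral_sum continuous_integrable cont
        finite_cartesian_product finite_lessThan)
  then show "conv_T G (fejer n) x = (1 / real n) * (\<Sum>p\<in>{..<n} \<times> {..<n}.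
    integral {0..1} (\<lambda>y. G y * cos (2 * pi * of_int (int (fst p) - int (snd p)) * y))
      * cos (2 * pi * of_int (int (fst p) - int (snd p)) * x)
    + integral {0..1} (\<lambda>y. G y * sin (2 * pi * of_int (int (fst p) - int (snd p)) * y))
      * sin (2 * pi * of_int (int (fst p) - int (snd p)) * x))"
    by (simp only: conv_T_cos_freq[OF assms])
qed

lemma trig_poly_fejer_mean: "CT G \<Longrightarrow> trig_poly (conv_T G (fejer n))"
  by (subst fejer_mean, assumption) (intro trig_poly_scale trig_poly_sum trig_poly_wave)

lemma cond_M_fejer_mean:
  assumes "CT G" "cond_M G"
  shows "cond_M (conv_T G (fejer n))"
  unfolding fejer_mean[OF assms(1)]
  by (intro cond_M_scale cond_M_sum cond_M_wave cond_M_cos_coeff_nonneg assms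
      continuous_intros finite_cartesian_product finite_lessThan) simp

text \<open>Only the \<open>n\<close> diagonal pairs have frequency zero. Hence (W) passes to every
  Fejer mean without loss.\<close>

lemma integral_fejer_mean:
  assumes "CT G" "n > 0"
  shows "integral {0..1} (conv_T G (fejer n)) = integral {0..1} G"
proof -
  let ?A = "\<lambda>k l. integral {0..1} (\<lambda>y. G y * cos (2 * pi * of_int (int k - int l) * y))"
  let ?B = "\<lambda>k l. integral {0..1} (\<lambda>y. G y * sin (2 * pi * of_int (int k - int l) * y))"
  have "((\<lambda>x. (1 / real n) * (\<Sum>p\<in>{..<n} \<times> {..<n}.
      ?A (fst p) (snd p) * cos (2 * pi * of_int (int (fst p) - int (snd p)) * x)
    + ?B (fst p) (snd p) * sin (2 * pi * of_int (int (fst p) - int (snd p)) * x))) has_integral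
    (1 / real n) * (\<Sum>p\<in>{..<n} \<times> {..<n}.
      ?A (fst p) (snd p) * (if int (fst p) - int (snd p) = 0 then 1 else 0) + ?B (fst p) (snd p) * 0)) {0..1}"
    by (intro has_integral_mult_right has_integral_sum has_integral_add has_integral_cos_freq
        has_integral_sin_freq) auto
  moreover have "(\<Sum>p\<in>{..<n} \<times> {..<n}. ?A (fst p) (snd p) * (if int (fst p) - int (snd p) = 0 then 1 else 0)
      + ?B (fst p) (snd p) * 0) = (\<Sum>k<n. \<Sum>l<n. if l = k then integral {0..1} G else 0)"
    unfolding sum.cartesian_product split_beta by (intro sum.cong) auto
  moreover have "\<dots> = real n * integral {0..1} G"
    by simp
  ultimately have "((\<lambda>x. (1 / real n) * (\<Sum>p\<in>{..<n} \<times> {..<n}.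
      ?A (fst p) (snd p) * cos (2 * pi * of_int (int (fst p) - int (snd p)) * x)
    + ?B (fst p) (snd p) * sin (2 * pi * of_int (int (fst p) - int (snd p)) * x))) has_integral
      integral {0..1} G) {0..1}"
    using assms(2) by simp
  then show ?thesis
    unfolding fejer_mean[OF assms(1)] by (rule integral_unique)
qed

subsection \<open>Convergence in \<open>C\<^sup>2\<close>\<close>

lemma abs_c2_norm_le:
  assumes "\<And>x. (f has_real_derivative f1 x) (at x)" "\<And>x. (f1 has_real_derivative f2 x) (at x)"
    and "\<And>x. \<bar>f x\<bar> \<le> a0" "\<And>x. \<bar>f1 x\<bar> \<le> a1" "\<And>x. \<bar>f2 x\<bar> \<le> a2"
  shows "\<bar>c2_norm f\<bar> \<le> a0 + a1 + a2"
proof -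
  have d: "deriv f = f1" "deriv f1 = f2"
    using assms(1,2) DERIV_imp_deriv by blast+
  have sup: "0 \<le> (SUP x\<in>{0..1}. \<bar>g x\<bar>) \<and> (SUP x\<in>{0..1}. \<bar>g x\<bar>) \<le> a"
    if "\<And>x. \<bar>g x\<bar> \<le> a" for g :: "real \<Rightarrow> real" and a
  proof
    show "0 \<le> (SUP x\<in>{0..1}. \<bar>g x\<bar>)"
      using that by (intro cSUP_upper2[of _ _ 0]) (auto intro!: bdd_aboveI[of _ a])
    show "(SUP x\<in>{0..1}. \<bar>g x\<bar>) \<le> a"
      using that by (intro cSUP_least) auto
  qed
  show ?thesis
    using sup[of f a0, OF assms(3)] sup[of f1 a1, OF assms(4)] sup[of f2 a2, OF assms(5)] unfolding c2_norm_def d by linarith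
qed

lemma c2_norm_tendsto_0:
  assumes f: "\<And>x. (f has_real_derivative f1 x) (at x)" "\<And>x. (f1 has_real_derivative f2 x) (at x)"
    and g: "\<And>n x. (g n has_real_derivative g1 n x) (at x)" "\<And>n x. (g1 n has_real_derivative g2 n x) (at x)"
    and lim: "uniform_limit UNIV g f sequentially" "uniform_limit UNIV g1 f1 sequentially"
      "uniform_limit UNIV g2 f2 sequentially"
  shows "(\<lambda>n. c2_norm (\<lambda>x. f x - g n x)) \<longlonglongrightarrow> 0"
proof (rule tendstoI)
  fix e :: real assume e: "e > 0"
  then have e4: "e / 4 > 0" by simp
  show "\<forall>\<^sub>F n in sequentially. dist (c2_norm (\<lambda>x. f x - g n x)) 0 < e"
    using uniform_limitD[OF lim(1) e4] uniform_limitD[OF lim(2) e4] uniform_limitD[OF lim(3) e4]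
  proof eventually_elim
    case (elim n)
    have "\<bar>c2_norm (\<lambda>x. f x - g n x)\<bar> \<le> e / 4 + e / 4 + e / 4"
    proof (rule abs_c2_norm_le)
      show "((\<lambda>x. f x - g n x) has_real_derivative f1 x - g1 n x) (at x)"
        "((\<lambda>x. f1 x - g1 n x) has_real_derivative f2 x - g2 n x) (at x)" for x
        by (intro DERIV_diff f g)+
      show "\<bar>f x - g n x\<bar> \<le> e / 4" "\<bar>f1 x - g1 n x\<bar> \<le> e / 4" "\<bar>f2 x - g2 n x\<bar> \<le> e / 4" for x
        using elim by (auto simp: dist_real_def abs_minus_commute less_imp_le)
    qed
    with e show ?case by simp
  qed
qed

text \<open>The error splits into \<open>g n - h\<close> convolved with \<open>m n\<close>, small
  because \<open>m n\<close> has mass one, and \<open>h\<close> convolved with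
  \<open>m n - \<mu>\<close>, small because \<open>h\<close> is bounded.\<close>

lemma uniform_limit_conv_T:
  assumes g: "\<And>n. CT (g n)" "CT h" "uniform_limit UNIV g h sequentially"
    and m: "\<And>n. density_T (m n)" "density_T \<mu>" "uniform_limit UNIV m \<mu> sequentially"
  shows "uniform_limit UNIV (\<lambda>n. conv_T (g n) (m n)) (conv_T h \<mu>) sequentially"
proof (rule uniform_limitI)
  fix e :: real assume e: "e > 0"
  obtain B where B: "B > 0" "\<And>x. \<bar>h x\<bar> \<le> B"
    using CT_bounded[OF g(2)] by metis
  have c: "continuous_on UNIV (g n)" "continuous_on UNIV h" "continuous_on UNIV (m n)"
    "continuous_on UNIV \<mu>" for n
    using g m by (auto simp: density_T_def CT_def)
  have e': "e / 3 > 0" "e / (3 * B) > 0"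
    using e B by auto
  show "\<forall>\<^sub>F n in sequentially. \<forall>x\<in>UNIV. dist (conv_T (g n) (m n) x) (conv_T h \<mu> x) < e"
    using uniform_limitD[OF g(3) e'(1)] uniform_limitD[OF m(3) e'(2)]
  proof eventually_elim
    case (elim n)
    show ?case
    proof
      fix x
      have "\<bar>conv_T (\<lambda>y. g n y - h y) (m n) x\<bar> \<le> e / 3"
        using elim(1) by (intro conv_T_density_bound m continuous_intros c)
          (auto simp: dist_real_def less_imp_le)
      moreover have "\<bar>conv_T h (\<lambda>y. m n y - \<mu> y) x\<bar> \<le> B * integral {0..1} (\<lambda>y. \<bar>m n y - \<mu> y\<bar>)"
        by (intro conv_T_bound continuous_intros c B)
      moreover have "B * integral {0..1} (\<lambda>y. \<bar>m n y - \<mu> y\<bar>) \<le> B * integral {0..1} (\<lambda>y::real. e / (3 * B))"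
        using elim(2) B by (intro mult_left_mono integral_mono_unit continuous_intros c)
          (auto simp: dist_real_def less_imp_le)
      moreover have "B * integral {0..1} (\<lambda>y::real. e / (3 * B)) = e / 3"
        using B by simp
      ultimately show "dist (conv_T (g n) (m n) x) (conv_T h \<mu> x) < e"
        using e unfolding conv_T_diff_left[OF c(1,2,3)] conv_T_diff_right[OF c(2,3,4)] dist_real_def
        by linarith
    qed
  qed
qed

section \<open>Uniqueness and regularity of solutions\<close>

context power_coupling
begin

text \<open>Stability with equal data, that is with \<open>D = 0\<close>; the a priori bounds supply
  the common interval for both solutions.\<close>

lemma sol_unique:
  assumes "C11 KG G" "C11 KV V" "cond_M G" "sol G V m1 H1" "sol G V m2 H2"
  shows "m1 = m2 \<and> H1 = H2"
proof -
  define K where "K = KG + KV + 1"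
  have "K > 0"
    using C11_nonneg[OF assms(1)] C11_nonneg[OF assms(2)] by (simp add: K_def)
  then obtain \<delta> M where \<delta>: "0 < \<delta>" "\<delta> \<le> M"
    and apriori: "\<And>u m. C11 K u \<Longrightarrow> CT m \<Longrightarrow> (\<And>x. 0 < m x) \<Longrightarrow> integral {0..1} m = 1 \<Longrightarrow>
      (\<And>x. c / m x powr \<alpha> = u x) \<Longrightarrow> \<forall>x. u x \<in> {\<delta>..M} \<and> m x \<in> {dens M..dens \<delta>}"
    using a_priori_bounds by metis
  have bound: "m x \<in> {dens M..dens \<delta>}" if "sol G V m H" for m H x
    using apriori[of "\<lambda>x. c / m x powr \<alpha>" m] C11_mono[OF sol_C11[OF that assms(1,2)], of K] that
    by (simp add: sol_def K_def)
  note ct = C11_CT[OF assms(1)] C11_CT[OF assms(2)]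
  obtain B where B: "B > 0" "\<And>x. \<bar>G x\<bar> \<le> B"
    using CT_bounded[OF ct(1)] by metis
  have d: "0 < dens M" "dens M \<le> dens \<delta>" "0 \<le> B"
    using \<delta> B by (auto intro: dens_pos dens_antimono)
  show ?thesis
  proof (rule sol_stability[OF d], goal_cases)
    case (1 C)
    have "\<bar>H1 - H2\<bar> \<le> C * 0 \<and> (\<forall>x. \<bar>m1 x - m2 x\<bar> \<le> C * 0)"
      using bound[OF assms(4)] bound[OF assms(5)]
      by (intro 1(2)[OF assms(4,5) ct(1) ct(1) ct(2) ct(2) assms(3) B(2)]) auto
    then show ?case by auto
  qed
qed

text \<open>Solving the equation for \<open>m\<close> gives a power of \<open>u\<close>, and
  \<open>u\<close> is twice differentiable because the derivatives fall on \<open>G\<close> and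
  \<open>V\<close>. The derivatives of \<open>m\<close> are spelled out in \<open>u\<close>,
  \<open>u1\<close>, \<open>u2\<close> so that uniform limits can later be taken factor by
  factor.\<close>

lemma sol_derivatives:
  assumes s: "sol G V m H"
    and G: "\<And>x. (G has_real_derivative G1 x) (at x)" "\<And>x. (G1 has_real_derivative G2 x) (at x)"
      "continuous_on UNIV G2"
    and V: "\<And>x. (V has_real_derivative V1 x) (at x)" "\<And>x. (V1 has_real_derivative V2 x) (at x)"
      "continuous_on UNIV V2"
  defines "u \<equiv> \<lambda>x. c / m x powr \<alpha>"
    and "u1 \<equiv> \<lambda>x. conv_T G1 m x - V1 x" and "u2 \<equiv> \<lambda>x. conv_T G2 m x - V2 x"
    and "p \<equiv> - (1 / \<alpha>)" and "A \<equiv> c powr (1 / \<alpha>)"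
  defines "m1 \<equiv> \<lambda>x. A * p * (u x powr (p - 1) * u1 x)"
    and "m2 \<equiv> \<lambda>x. A * p * ((p - 1) * (u x powr (p - 2) * (u1 x * u1 x)) + u x powr (p - 1) * u2 x)"
  shows "m = (\<lambda>x. A * u x powr p)"
    and "\<And>x. (m has_real_derivative m1 x) (at x)" and "\<And>x. (m1 has_real_derivative m2 x) (at x)"
    and "C2T m"
proof -
  have mc: "continuous_on UNIV m" and mpos: "\<And>x. m x > 0" and mp: "periodic1 m"
    using s by (auto simp: sol_def CT_def)
  have upos: "u x > 0" for x
    using c mpos[of x] by (simp add: u_def)
  have u_eq: "u = (\<lambda>x. conv_T G m x - V x + H)"
    using s by (auto simp: sol_def u_def fun_eq_iff algebra_simps)
  have G1c: "continuous_on UNIV G1" and V1c: "continuous_on UNIV V1"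
    using has_derivative_continuous_on[OF G(2)] has_derivative_continuous_on[OF V(2)] .
  have du: "(u has_real_derivative u1 x) (at x)" for x
    unfolding u_eq u1_def
    using has_derivative_conv_T[OF G(1) G1c mc, of x] V(1)[of x]
    by (auto intro!: derivative_eq_intros)
  have du1: "(u1 has_real_derivative u2 x) (at x)" for x
    unfolding u1_def u2_def
    using has_derivative_conv_T[OF G(2,3) mc, of x] V(2)[of x]
    by (auto intro!: derivative_eq_intros)
  have m_eq: "m x = A * u x powr p" for x
  proof -
    have "m x = dens (u x)"
      using dens_eq_iff[OF upos mpos, of x x] by (simp add: u_def)
    also have "\<dots> = A * u x powr p"
      using upos[of x] c by (simp add: dens_def A_def p_def powr_divide powr_minus_divide)
    finally show ?thesis .
  qed
  then show m_fun: "m = (\<lambda>x. A * u x powr p)"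
    by blast
  have dpow: "((\<lambda>x. u x powr q) has_real_derivative q * u x powr (q - 1) * u1 x) (at x)" for q x
    using DERIV_fun_powr[OF du[of x] upos[of x], of q] by simp
  show dm: "(m has_real_derivative m1 x) (at x)" for x
    unfolding m_fun m1_def
    by (rule DERIV_cmult[OF dpow[of p x], of A, THEN DERIV_cong]) (simp add: mult_ac)
  show dm1: "(m1 has_real_derivative m2 x) (at x)" for x
    unfolding m1_def
    by (rule DERIV_cmult[OF DERIV_mult[OF dpow[of "p - 1" x] du1[of x]], of "A * p", THEN DERIV_cong])
      (simp add: m2_def algebra_simps)
  have uc: "continuous_on UNIV u" "continuous_on UNIV u1"
    using has_derivative_continuous_on[OF du] has_derivative_continuous_on[OF du1] .
  have "continuous_on UNIV m2"
    unfolding m2_def u2_def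
    by (intro continuous_intros uc continuous_conv_T G V mc)
      (simp_all add: less_imp_neq[OF upos, symmetric])
  with dm dm1 mp show "C2T m"
    unfolding C2T_def by blast
qed

end

text \<open>The lower bound \<open>\<delta>\<close> keeps the values in a compact interval away from
  0, where negative powers are singular; there the power is uniformly continuous.\<close>

lemma uniform_limit_powr:
  fixes u :: "nat \<Rightarrow> real \<Rightarrow> real"
  assumes "uniform_limit UNIV u v sequentially" "0 < \<delta>" "\<And>n x. u n x \<in> {\<delta>..M}"
  shows "uniform_limit UNIV (\<lambda>n x. u n x powr q) (\<lambda>x. v x powr q) sequentially"
proof (rule uniform_limit_compose_uniformly_continuous_on
    [where B = "{\<delta>..M}" and f = "\<lambda>t. t powr q" and g = u and g' = v])
  show "uniformly_continuous_on {\<delta>..M} (\<lambda>x. x powr q)"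
    using assms(2) by (intro compact_uniformly_continuous continuous_intros) auto
qed (use assms in auto)

lemma uniform_limit_mult_bounded:
  fixes f g :: "nat \<Rightarrow> real \<Rightarrow> real"
  assumes "uniform_limit UNIV f l sequentially" "uniform_limit UNIV g m sequentially"
    and "\<And>x. \<bar>l x\<bar> \<le> a" "\<And>x. \<bar>m x\<bar> \<le> b"
  shows "uniform_limit UNIV (\<lambda>n x. f n x * g n x) (\<lambda>x. l x * m x) sequentially"
  using assms by (intro uniform_lim_mult) (auto simp: bounded_iff)

lemma solves_P_iff:
  assumes "power_coupling \<alpha> (j\<^sup>2 / 2)"
  shows "solves_P \<alpha> j V G m H \<longleftrightarrow> power_coupling.sol \<alpha> (j\<^sup>2 / 2) G V m H"
  using power_coupling.sol_def[OF assms] by (simp add: solves_P_def)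

theorem theorem1p4:
  fixes \<alpha> j :: real and V G :: "real \<Rightarrow> real"
  assumes "0 < \<alpha>" and "\<alpha> \<le> 2" and "j \<noteq> 0"
    and "C2T G" and "C2T V"
    and "cond_M G" and "cond_W G"
  shows "\<exists>Gs :: nat \<Rightarrow> real \<Rightarrow> real.
     (\<forall>n. trig_poly (Gs n) \<and> cond_M (Gs n) \<and> cond_W (Gs n)) \<and>
     (\<lambda>n. c2_norm (\<lambda>x. G x - Gs n x)) \<longlonglongrightarrow> 0 \<and>
     (\<forall>n. \<exists>!p. solves_P \<alpha> j V (Gs n) (fst p) (snd p)) \<and>
     (\<forall>ms Hs. (\<forall>n. solves_P \<alpha> j V (Gs n) (ms n) (Hs n)) \<longrightarrow>
        (\<exists>m H. C2T m \<and> (\<forall>n. C2T (ms n)) \<and>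
           (\<lambda>n. c2_norm (\<lambda>x. m x - ms n x)) \<longlonglongrightarrow> 0 \<and>
           Hs \<longlonglongrightarrow> H \<and>
           solves_P \<alpha> j V G m H \<and>
           (\<forall>m' H'. solves_P \<alpha> j V G m' H' \<longrightarrow> m' = m \<and> H' = H)))"
proof -
  interpret power_coupling \<alpha> "j\<^sup>2 / 2"
    using assms by unfold_locales auto
  note sol_iff = solves_P_iff[OF power_coupling_axioms]
  obtain G1 G2 where G: "\<And>x. (G has_real_derivative G1 x) (at x)"
    "\<And>x. (G1 has_real_derivative G2 x) (at x)" "CT G" "CT G1" "CT G2"
    using C2T_obtain[OF assms(4)] by metis
  obtain V1 V2 where V: "\<And>x. (V has_real_derivative V1 x) (at x)"
    "\<And>x. (V1 has_real_derivative V2 x) (at x)" "CT V" "CT V1" "CT V2"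
    using C2T_obtain[OF assms(5)] by metis
  obtain KG where KG: "KG > 0" "\<And>x. \<bar>G2 x\<bar> \<le> KG"
    using CT_bounded[OF G(5)] by metis
  obtain KV where KV: "KV > 0" "\<And>x. \<bar>V2 x\<bar> \<le> KV"
    using CT_bounded[OF V(5)] by metis
  have G11: "C11 KG G"
    using CT_D(1)[OF G(3)] G(1,2) KG(2) by (rule C11I)
  have V11: "C11 KV V"
    using CT_D(1)[OF V(3)] V(1,2) KV(2) by (rule C11I)
  \<comment> \<open>The successor skips \<open>fejer 0\<close>, which is the zero function and has
    no mass.\<close>
  define F where "F n = fejer (Suc n)" for n
  have F: "density_T (F n)" "CT (F n)" "continuous_on UNIV (F n)" for n
    by (auto simp: F_def density_fejer CT_fejer continuous_fejer)
  define Gs where "Gs n = conv_T G (F n)" for n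
  define Gs1 where "Gs1 n = conv_T G1 (F n)" for n
  define Gs2 where "Gs2 n = conv_T G2 (F n)" for n
  have Gs: "(Gs n has_real_derivative Gs1 n x) (at x)" "(Gs1 n has_real_derivative Gs2 n x) (at x)"
    "CT (Gs n)" "CT (Gs1 n)" "CT (Gs2 n)" for n x
    unfolding Gs_def Gs1_def Gs2_def
    by (intro has_derivative_conv_T CT_conv_T G F CT_D(2)[OF G(4)] CT_D(2)[OF G(5)])+
  have Gs_lim: "uniform_limit UNIV Gs G sequentially" "uniform_limit UNIV Gs1 G1 sequentially"
    "uniform_limit UNIV Gs2 G2 sequentially"
    using fejer_uniform_limit[OF G(3)] fejer_uniform_limit[OF G(4)] fejer_uniform_limit[OF G(5)]
    by (simp_all add: Gs_def[abs_def] Gs1_def[abs_def] Gs2_def[abs_def] F_def)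
  \<comment> \<open>One constant for all \<open>n\<close>, which makes the bounds on the
    \<open>ms n\<close> uniform.\<close>
  have Gs11: "C11 KG (Gs n)" for n
    unfolding Gs_def by (rule C11_conv_T[OF G11 F(1)])
  have Gs_M: "cond_M (Gs n)" for n
    unfolding Gs_def F_def by (rule cond_M_fejer_mean[OF G(3) assms(6)])

  obtain m H where mH: "sol G V m H"
    using sol_exists[OF G11 V11 assms(6)] by metis

  have part1: "trig_poly (Gs n) \<and> cond_M (Gs n) \<and> cond_W (Gs n)" for n
    using trig_poly_fejer_mean[OF G(3)] integral_fejer_mean[OF G(3), of "Suc n"] assms(7) Gs_M
    by (simp add: cond_W_def Gs_def F_def)
  have part2: "(\<lambda>n. c2_norm (\<lambda>x. G x - Gs n x)) \<longlonglongrightarrow> 0"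
    using G(1,2) Gs(1,2) Gs_lim by (rule c2_norm_tendsto_0)
  have part3: "\<exists>!p. solves_P \<alpha> j V (Gs n) (fst p) (snd p)" for n
  proof -
    obtain m H where "sol (Gs n) V m H"
      using sol_exists[OF Gs11 V11 Gs_M] by metis
    then show ?thesis
      unfolding sol_iff using sol_unique[OF Gs11 V11 Gs_M]
      by (intro ex1I[of _ "(m, H)"]) (auto simp: prod_eq_iff)
  qed
  have part4: "C2T m \<and> (\<forall>n. C2T (ms n)) \<and> (\<lambda>n. c2_norm (\<lambda>x. m x - ms n x)) \<longlonglongrightarrow> 0 \<and> Hs \<longlonglongrightarrow> H"
    if "\<And>n. sol (Gs n) V (ms n) (Hs n)" for ms Hs
  proof -
    note s = that
    define K where "K = KG + KV"
    have "K > 0"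
      using KG KV by (simp add: K_def)
    then obtain \<delta> M where \<delta>: "0 < \<delta>" "\<delta> \<le> M"
      and apriori: "\<And>u m. C11 K u \<Longrightarrow> CT m \<Longrightarrow> (\<And>x. 0 < m x) \<Longrightarrow> integral {0..1} m = 1 \<Longrightarrow>
        (\<And>x. j\<^sup>2 / 2 / m x powr \<alpha> = u x) \<Longrightarrow> \<forall>x. u x \<in> {\<delta>..M} \<and> m x \<in> {dens M..dens \<delta>}"
      using a_priori_bounds by metis
    \<comment> \<open>The kernel enters only through \<open>KG\<close>, so this applies to
      \<open>G\<close> and to every \<open>Gs n\<close> with the same \<open>\<delta>\<close> and
      \<open>M\<close>.\<close>
    have bound: "j\<^sup>2 / 2 / \<mu> x powr \<alpha> \<in> {\<delta>..M} \<and> \<mu> x \<in> {dens M..dens \<delta>}"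
      if "sol g V \<mu> h" "C11 KG g" for g \<mu> h x
      using apriori[of "\<lambda>x. j\<^sup>2 / 2 / \<mu> x powr \<alpha>" \<mu>] sol_C11[OF that V11] that
      by (simp add: sol_def K_def)
    obtain B where B: "B > 0" "\<And>x. \<bar>G x\<bar> \<le> B"
      using CT_bounded[OF G(3)] by metis
    have "0 < dens M" "dens M \<le> dens \<delta>" "0 \<le> B"
      using \<delta> B by (auto intro: dens_pos dens_antimono)
    then obtain C where C: "C > 0" and stab:
      "\<And>G1 G2 V1 V2 m1 m2 H1 H2 D. sol G1 V1 m1 H1 \<Longrightarrow> sol G2 V2 m2 H2 \<Longrightarrow>
         CT G1 \<Longrightarrow> CT G2 \<Longrightarrow> CT V1 \<Longrightarrow> CT V2 \<Longrightarrow> cond_M G1 \<Longrightarrow> (\<And>x. \<bar>G1 x\<bar> \<le> B) \<Longrightarrow>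
         (\<And>x. m1 x \<in> {dens M..dens \<delta>}) \<Longrightarrow> (\<And>x. m2 x \<in> {dens M..dens \<delta>}) \<Longrightarrow>
         (\<And>x. \<bar>conv_T G1 m2 x - conv_T G2 m2 x\<bar> + \<bar>V1 x - V2 x\<bar> \<le> D) \<Longrightarrow>
         \<bar>H1 - H2\<bar> \<le> C * D \<and> (\<forall>x. \<bar>m1 x - m2 x\<bar> \<le> C * D)"
      using sol_stability[of "dens M" "dens \<delta>" B] by metis
    have close: "\<forall>\<^sub>F n in sequentially. \<bar>H - Hs n\<bar> < e \<and> (\<forall>x. \<bar>m x - ms n x\<bar> < e)" if e: "e > 0" for e
    proof -
      \<comment> \<open>Stability compares the kernels \<open>G\<close> and \<open>Gs n\<close> with
        equal potentials, so \<open>D\<close> is the sup distance of the kernels; the factor 2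
        leaves room for the strict inequality.\<close>
      have "e / (2 * C) > 0"
        using e C by simp
      from uniform_limitD[OF Gs_lim(1) this] show ?thesis
      proof eventually_elim
        case (elim n)
        have "\<bar>conv_T G (ms n) x - conv_T (Gs n) (ms n) x\<bar> + \<bar>V x - V x\<bar> \<le> e / (2 * C)" for x
        proof -
          have c: "continuous_on UNIV (ms n)"
            using s[of n] by (simp add: sol_def CT_def)
          have "\<bar>conv_T (\<lambda>y. G y - Gs n y) (ms n) x\<bar> \<le> e / (2 * C)"
            using elim sol_density[OF s] CT_D(2)[OF G(3)] CT_D(2)[OF Gs(3)]
            by (intro conv_T_density_bound continuous_intros)
              (auto simp: dist_real_def abs_minus_commute less_imp_le)
          then show ?thesis
            by (simp add: conv_T_diff_left[OF CT_D(2)[OF G(3)] CT_D(2)[OF Gs(3)] c])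
        qed
        then have "\<bar>H - Hs n\<bar> \<le> C * (e / (2 * C)) \<and> (\<forall>x. \<bar>m x - ms n x\<bar> \<le> C * (e / (2 * C)))"
          using bound[OF mH G11] bound[OF s Gs11]
          by (intro stab[OF mH s G(3) Gs(3) V(3) V(3) assms(6) B(2)]) auto
        moreover have "C * (e / (2 * C)) < e"
          using e C by simp
        ultimately show ?case
          by (meson le_less_trans)
      qed
    qed
    have Hs_lim: "Hs \<longlonglongrightarrow> H"
    proof (rule tendstoI)
      fix e :: real assume "e > 0"
      from close[OF this] show "\<forall>\<^sub>F n in sequentially. dist (Hs n) H < e"
        by eventually_elim (simp add: dist_real_def abs_minus_commute)
    qed
    have ms_lim: "uniform_limit UNIV ms m sequentially"
    proof (rule uniform_limitI)
      fix e :: real assume "e > 0"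
      from close[OF this] show "\<forall>\<^sub>F n in sequentially. \<forall>x\<in>UNIV. dist (ms n x) (m x) < e"
        by eventually_elim (simp add: dist_real_def abs_minus_commute)
    qed
    define p where "p = - (1 / \<alpha>)"
    define A where "A = (j\<^sup>2 / 2) powr (1 / \<alpha>)"
    define u where "u = (\<lambda>x. j\<^sup>2 / 2 / m x powr \<alpha>)"
    define u1 where "u1 = (\<lambda>x. conv_T G1 m x - V1 x)"
    define u2 where "u2 = (\<lambda>x. conv_T G2 m x - V2 x)"
    define us where "us = (\<lambda>n x. j\<^sup>2 / 2 / ms n x powr \<alpha>)"
    define us1 where "us1 = (\<lambda>n x. conv_T (Gs1 n) (ms n) x - V1 x)"
    define us2 where "us2 = (\<lambda>n x. conv_T (Gs2 n) (ms n) x - V2 x)"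
    note dm = sol_derivatives[OF mH G(1,2) CT_D(2)[OF G(5)] V(1,2) CT_D(2)[OF V(5)],
        folded p_def A_def]
    note dms = sol_derivatives[OF s Gs(1,2) CT_D(2)[OF Gs(5)] V(1,2) CT_D(2)[OF V(5)],
        folded p_def A_def]
    have dens: "density_T m" "density_T (ms n)" for n
      using mH s sol_density by blast+
    have ub: "u x \<in> {\<delta>..M}" "us n x \<in> {\<delta>..M}" for n x
      using bound[OF mH G11] bound[OF s Gs11] by (auto simp: u_def us_def)
    have u_eq: "u = (\<lambda>x. conv_T G m x - V x + H)" "us = (\<lambda>n x. conv_T (Gs n) (ms n) x - V x + Hs n)"
      using mH s by (auto simp: sol_def u_def us_def fun_eq_iff algebra_simps)
    have "uniform_limit UNIV (\<lambda>n x. Hs n) (\<lambda>x::real. H) sequentially"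
      using Hs_lim by (auto simp: uniform_limit_iff tendsto_iff)
    then have u_lim: "uniform_limit UNIV us u sequentially"
      unfolding u_eq
      by (intro uniform_limit_add uniform_limit_minus uniform_limit_const uniform_limit_conv_T
          Gs G Gs_lim ms_lim dens)
    have u1_lim: "uniform_limit UNIV us1 u1 sequentially"
      unfolding us1_def u1_def
      by (intro uniform_limit_minus uniform_limit_const uniform_limit_conv_T Gs G Gs_lim ms_lim dens)
    have u2_lim: "uniform_limit UNIV us2 u2 sequentially"
      unfolding us2_def u2_def
      by (intro uniform_limit_minus uniform_limit_const uniform_limit_conv_T Gs G Gs_lim ms_lim dens)
    have pow_lim: "uniform_limit UNIV (\<lambda>n x. us n x powr q) (\<lambda>x. u x powr q) sequentially" for q
      using u_lim \<delta>(1) ub(2) by (rule uniform_limit_powr)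
    have ct: "CT u" "CT u1" "CT u2"
      using CT_conv_T[OF G(3)] CT_conv_T[OF G(4)] CT_conv_T[OF G(5)] V(3-5) mH
      unfolding u_eq u1_def u2_def
      by (auto simp: sol_def CT_def periodic1_def intro!: continuous_intros)
    have upos: "u x > 0" for x
      using ub(1)[of x] \<delta>(1) by simp
    have ct_pow: "CT (\<lambda>x. u x powr q)" for q
      using ct(1) upos unfolding CT_def periodic1_def
      by (auto intro!: continuous_intros simp: less_imp_neq[symmetric])
    \<comment> \<open>Products of uniformly convergent sequences converge uniformly when the limits
      are bounded; these bounds come from periodicity and continuity.\<close>
    obtain b1 b2 where b: "\<And>x. \<bar>u1 x\<bar> \<le> b1" "\<And>x. \<bar>u2 x\<bar> \<le> b2"
      using CT_bounded[OF ct(2)] CT_bounded[OF ct(3)] by metis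
    have "\<exists>B. \<forall>x. \<bar>u x powr q\<bar> \<le> B" for q
      by (rule CT_bounded[OF ct_pow[of q]]) blast
    then obtain bp where bp: "\<And>q x. \<bar>u x powr q\<bar> \<le> bp q"
      by metis
    have bb: "\<bar>u1 x * u1 x\<bar> \<le> b1 * b1" for x
      using mult_mono[OF b(1)[of x] b(1)[of x]] b(1)[of x] by (simp add: abs_mult)
    have const: "uniform_limit UNIV (\<lambda>n x. r * f n x) (\<lambda>x. r * l x) sequentially"
      if "uniform_limit UNIV f l sequentially" for r and f :: "nat \<Rightarrow> real \<Rightarrow> real" and l
      using that by (rule bounded_linear_uniform_limit_intros)
    have m_lim1: "uniform_limit UNIV (\<lambda>n x. A * p * (us n x powr (p - 1) * us1 n x))
        (\<lambda>x. A * p * (u x powr (p - 1) * u1 x)) sequentially"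
      by (intro const uniform_limit_mult_bounded[OF pow_lim u1_lim bp b(1)])
    have m_lim2: "uniform_limit UNIV
        (\<lambda>n x. A * p * ((p - 1) * (us n x powr (p - 2) * (us1 n x * us1 n x)) + us n x powr (p - 1) * us2 n x))
        (\<lambda>x. A * p * ((p - 1) * (u x powr (p - 2) * (u1 x * u1 x)) + u x powr (p - 1) * u2 x)) sequentially"
      by (intro const uniform_limit_add uniform_limit_mult_bounded[OF pow_lim u2_lim bp b(2)]
          uniform_limit_mult_bounded[OF pow_lim
            uniform_limit_mult_bounded[OF u1_lim u1_lim b(1) b(1)] bp bb])
    have "(\<lambda>n. c2_norm (\<lambda>x. m x - ms n x)) \<longlonglongrightarrow> 0"
      using dm(2,3) dms(2,3) ms_lim m_lim1[unfolded u_def u1_def us_def us1_def]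
        m_lim2[unfolded u_def u1_def u2_def us_def us1_def us2_def]
      by (rule c2_norm_tendsto_0)
    with dm(4) dms(4) Hs_lim show ?thesis
      by blast
  qed
  have "\<exists>m H. C2T m \<and> (\<forall>n. C2T (ms n)) \<and> (\<lambda>n. c2_norm (\<lambda>x. m x - ms n x)) \<longlonglongrightarrow> 0 \<and> Hs \<longlonglongrightarrow> H \<and>
      solves_P \<alpha> j V G m H \<and> (\<forall>m' H'. solves_P \<alpha> j V G m' H' \<longrightarrow> m' = m \<and> H' = H)"
    if "\<forall>n. solves_P \<alpha> j V (Gs n) (ms n) (Hs n)" for ms Hs
    using part4[of ms Hs] that mH sol_unique[OF G11 V11 assms(6) _ mH] unfolding sol_iff
    by (intro exI[of _ m] exI[of _ H]) blast
  with part1 part2 part3 show ?thesis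
    by blast
qed

end
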